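(* Let $\mathcal{P}=\{A_1,\dots,A_m\}$ be a partition of the support $\mathcal{S}$ of $p(\mathbf{s})$, let $Q(z\mid\mathbf{s})$ be a fixed class-probability predictor, and let $\epsilon_1,\epsilon_2,\sigma^2$ be as defined in the context. Assume: (i) (maximum mutual information gain) $\max_{A\in\mathcal{P}}I(\mathbf{S};Z\mid A)-I(\mathbf{S};Z)=\Delta\ge 0$; (ii) (sufficient number of unlabeled samples) for all $A\in\mathcal{P}$, $$\frac{1}{|A\cap\mathcal{S}_u|}\sum_{\mathbf{s}\in A\cap\mathcal{S}_u}\mathbb{E}_{Z\sim Q(z\mid\mathbf{s})}\left[\log\frac{Q(Z\mid\mathbf{s})}{P(Z\mid\mathbf{s})}\right]\approx D_{\mathrm{KL}}\bigl(Q(z\mid\mathbf{s})\,\|\,P(z\mid\mathbf{s})\mid A\bigr).$$ Then the partition-based active test (defined in the context), with label budget $N_q$ and significance level $\alpha$, has testing power of approximately at least $$\Phi\left(\frac{\frac{\log\alpha}{\sqrt{N_q}}+\sqrt{N_q}\left(I(\mathbf{S};Z)+\Delta-2\sqrt{\epsilon_1}-\sqrt{\epsilon_2}\right)}{\left(\epsilon_1+\sigma^2+2\sigma\sqrt{\epsilon_1}\right)^{1/2}}\right),$$ and the baseline test (defined in the context), in which features are randomly sampled from $\mathcal{S}_u$ and labeled, with the same $N_q$ and $\alpha$, has testing power of approximately at least $$\Phi\left(\frac{\frac{\log\alpha}{\sqrt{N_q}}+\sqrt{N_q}\left(I(\mathbf{S};Z)-\sqrt{\epsilon_1}\right)}{\left(\epsilon_1+\sigma^2+2\sigma\sqrt{\epsilon_1}\right)^{1/2}}\right).$$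 Here $\Phi$ is the standard normal cumulative distribution function.
   Context: Data. $(\mathbf{S},Z)\in\mathbb{R}^d\times\{0,1\}$ has joint distribution $p(\mathbf{s},z)=P(z\mid\mathbf{s})p(\mathbf{s})$, and $P(z)$ is the marginal of $Z$. $\mathcal{S}_u$ is a set of unlabeled features drawn i.i.d. from $p(\mathbf{s})$; an oracle queried at $\mathbf{s}$ returns a label drawn from $P(\cdot\mid\mathbf{s})$. The null hypothesis $H_0$ is that $\mathbf{S}$ and $Z$ are independent; $H_1$ is its negation. Testing power is the probability of rejecting $H_0$ when $H_1$ is true. Conditioning on $A$ means conditioning on $\mathbf{S}\in A$: $p(\mathbf{s},z\mid A)=P(z\mid\mathbf{s})p(\mathbf{s}\mid A)$, with label marginal $P(z\mid A)$, and $I(\mathbf{S};Z\mid A)$ is the mutual information under $p(\mathbf{s},z\mid A)$. Predictor and error quantities. $Q(z\mid\mathbf{s})$ is initialized from a labeled set of features randomly sampled from $\mathcal{S}_u$ and is kept fixed during testing. Put $q(\mathbf{s},z)=Q(z\mid\mathbf{s})p(\mathbf{s})$ and $q(\mathbf{s},z\mid A)=Q(z\mid\mathbf{s})p(\mathbf{s}\mid A)$. Then $$\epsilon_1=\max_{A\in\mathcal{P}}\mathbb{E}_{(\mathbf{S},Z)\sim p(\mathbf{s},z\mid A)}\left[\log^2\frac{Q(Z\mid\mathbf{S})}{P(Z\mid\mathbf{S})}\right],\qquad \epsilon_2=\max_{A\in\mathcal{P}}\mathbb{E}_{(\mathbf{S},Z)\sim q(\mathbf{s},z\mid A)}\left[\log^2\frac{P(Z\mid\mathbf{S})}{Q(Z\mid\mathbf{S})}\right],$$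 $$\sigma^2=\max\left\{\max_{A\in\mathcal{P}}\mathrm{Var}_{(\mathbf{S},Z)\sim p(\mathbf{s},z\mid A)}\left[-\log\frac{P(Z\mid A)}{P(Z\mid\mathbf{S})}\right],\ \mathrm{Var}_{(\mathbf{S},Z)\sim p(\mathbf{s},z)}\left[-\log\frac{P(Z)}{P(Z\mid\mathbf{S})}\right]\right\},$$ and $D_{\mathrm{KL}}(Q(z\mid\mathbf{s})\|P(z\mid\mathbf{s})\mid A)=\mathbb{E}_{(\mathbf{S},Z)\sim q(\mathbf{s},z\mid A)}\left[\log\frac{Q(Z\mid\mathbf{S})}{P(Z\mid\mathbf{S})}\right]$. Partition-based active test. Given $N_q,\alpha,\mathcal{S}_u,\mathcal{P}$ and the class priors $P(Z=0\mid A_1),\dots,P(Z=0\mid A_m)$, the analyst computes for each $i$ $$\hat I(\mathbf{S};Z\mid A_i)=-\sum_{z=0}^1P(Z=z\mid A_i)\log P(Z=z\mid A_i)+\frac{\sum_{\mathbf{s}\in A_i\cap\mathcal{S}_u}\sum_{z=0}^1Q(Z=z\mid\mathbf{s})\log Q(Z=z\mid\mathbf{s})}{|A_i\cap\mathcal{S}_u|},$$ selects $A^*=\arg\max_{A\in\mathcal{P}}\hat I(\mathbf{S};Z\mid A)$, and sequentially labels features randomly sampled from $A^*\cap\mathcal{S}_u$, so that the pairs $(\mathbf{S}_i,Z_i)$ are i.i.d. from $p(\mathbf{s},z\mid A^* )$. After the $n$-th label it forms $w_n=\prod_{i=1}^n\frac{P(z_i\mid A^* )}{Q(z_i\mid\mathbf{s}_i)}$,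 rejects $H_0$ as soon as $w_n\le\alpha$, and retains $H_0$ if the budget of $N_q$ labels (counted after initialization) runs out. Baseline test. Given $N_q,\alpha,\mathcal{S}_u$ and $P(Z=0)$, the analyst sequentially labels features randomly sampled from $\mathcal{S}_u$, so that the pairs $(\mathbf{S}_i,Z_i)$ are i.i.d. from $p(\mathbf{s},z)$, forms $w_n=\prod_{i=1}^n\frac{P(z_i)}{Q(z_i\mid\mathbf{s}_i)}$, rejects $H_0$ as soon as $w_n\le\alpha$, and retains $H_0$ if the budget of $N_q$ labels runs out. Meaning of "approximately". In the power bounds it refers to the central-limit (normal) approximation of the distribution of $\frac1{N_q}\sum_{i=1}^{N_q}\log\frac{P(Z_i)}{Q(Z_i\mid\mathbf{S}_i)}$ (with $P(Z_i\mid A^* )$ in place of $P(Z_i)$ for the partition-based active test); in assumption (ii), "$\approx$" means that the unlabeled sample is large enough that the empirical average over $A\cap\mathcal{S}_u$ may be identified with the corresponding expectation under $p(\mathbf{s}\mid A)$.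
   Formalization: (ii) is also required of the pool average of log Q in the estimate of I (for Q=P, (ii) as written is vacuous and the active bound can fail); where the argument of Φ is negative, the bound holds only as N_q→∞ for fixed α, since enlarging the variance then breaks it. *)

theory Defs
  imports "HOL-Probability.Probability"
begin

text \<open>
  Labels have type \<^typ>\<open>bool\<close>: \<^term>\<open>False\<close> is 0 and \<^term>\<open>True\<close> is 1. A conditional label law such as
  P(z|s) or Q(z|s) is a function from features to \<^typ>\<open>bool pmf\<close>. All logarithms are natural.
  The feature law p(s) is an arbitrary Borel probability measure \<open>D\<close>; every quantity "given A"
  is the same quantity with \<open>D\<close> replaced by p(s|A), that is, by \<open>uniform_measure D A\<close>
  (the library's conditional distribution, B \<open>\<mapsto>\<close> D (A \<inter> B) / D A).
\<close>

type_synonym 'd kernel = "real ^ 'd \<Rightarrow> bool pmf"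

definition joint :: "(real ^ 'd) measure \<Rightarrow> 'd kernel \<Rightarrow> ((real ^ 'd) \<times> bool) measure" where
  "joint D K = density (D \<Otimes>\<^sub>M count_space UNIV) (\<lambda>(s, z). ennreal (pmf (K s) z))"

definition label_marginal :: "(real ^ 'd) measure \<Rightarrow> 'd kernel \<Rightarrow> bool \<Rightarrow> real" where
  "label_marginal D K z = measure (joint D K) {x \<in> space (joint D K). snd x = z}"

definition mutual_info :: "(real ^ 'd) measure \<Rightarrow> 'd kernel \<Rightarrow> real" where
  "mutual_info D P = prob_space.mutual_information (joint D P) (exp 1) borel (count_space UNIV) fst snd"

definition alternative_H1 :: "(real ^ 'd) measure \<Rightarrow> 'd kernel \<Rightarrow> bool" where
  "alternative_H1 D P \<longleftrightarrow>
     \<not> prob_space.indep_set (joint D P)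
         {fst -` B \<inter> space (joint D P) | B. B \<in> sets borel}
         {snd -` C \<inter> space (joint D P) | C. True}"

definition topological_support :: "(real ^ 'd) measure \<Rightarrow> (real ^ 'd) set" where
  "topological_support D = {s. \<forall>U. open U \<longrightarrow> s \<in> U \<longrightarrow> measure D U > 0}"

definition var :: "'a measure \<Rightarrow> ('a \<Rightarrow> real) \<Rightarrow> real" where
  "var M f = (\<integral>x. (f x - (\<integral>y. f y \<partial>M))\<^sup>2 \<partial>M)"


subsection \<open>Error quantities\<close>

text \<open>\<open>log_ratio K L\<close> is (s, z) \<open>\<mapsto>\<close> log (K(z|s) / L(z|s)). Since \<open>ln 0 = 0\<close> and \<open>x / 0 = 0\<close>, it is
  meaningful only if P and Q vanish at the same labels, almost everywhere in s; otherwise one of the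
  error quantities below should be infinite. The theorem assumes this and the integrability of the
  squared log-ratios, i.e. that both error quantities are finite.\<close>

definition log_ratio :: "'d kernel \<Rightarrow> 'd kernel \<Rightarrow> (real ^ 'd) \<times> bool \<Rightarrow> real" where
  "log_ratio K L = (\<lambda>(s, z). ln (pmf (K s) z / pmf (L s) z))"

definition eps1 :: "(real ^ 'd) measure \<Rightarrow> 'd kernel \<Rightarrow> 'd kernel \<Rightarrow> (real ^ 'd) set set \<Rightarrow> real" where
  "eps1 D P Q \<P> =
     Max ((\<lambda>A. \<integral>x. (log_ratio Q P x)\<^sup>2 \<partial>joint (uniform_measure D A) P) ` \<P>)"

definition eps2 :: "(real ^ 'd) measure \<Rightarrow> 'd kernel \<Rightarrow> 'd kernel \<Rightarrow> (real ^ 'd) set set \<Rightarrow> real" where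
  "eps2 D P Q \<P> =
     Max ((\<lambda>A. \<integral>x. (log_ratio P Q x)\<^sup>2 \<partial>joint (uniform_measure D A) Q) ` \<P>)"

definition info_var :: "(real ^ 'd) measure \<Rightarrow> 'd kernel \<Rightarrow> real" where
  "info_var D P = var (joint D P) (\<lambda>(s, z). - ln (label_marginal D P z / pmf (P s) z))"

definition sigma_sq :: "(real ^ 'd) measure \<Rightarrow> 'd kernel \<Rightarrow> (real ^ 'd) set set \<Rightarrow> real" where
  "sigma_sq D P \<P> = max (Max ((\<lambda>A. info_var (uniform_measure D A) P) ` \<P>)) (info_var D P)"

definition cond_KL :: "(real ^ 'd) measure \<Rightarrow> 'd kernel \<Rightarrow> 'd kernel \<Rightarrow> (real ^ 'd) set \<Rightarrow> real" where
  "cond_KL D Q P A = (\<integral>x. log_ratio Q P x \<partial>joint (uniform_measure D A) Q)"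


subsection \<open>Selection of the query region\<close>

definition pool_average ::
  "(real ^ 'd) set \<Rightarrow> (real ^ 'd) set \<Rightarrow> (real ^ 'd \<Rightarrow> real) \<Rightarrow> real" where
  "pool_average Su A f = (\<Sum>s\<in>A \<inter> Su. f s) / real (card (A \<inter> Su))"

definition info_estimate ::
  "(real ^ 'd) measure \<Rightarrow> 'd kernel \<Rightarrow> 'd kernel \<Rightarrow> (real ^ 'd) set \<Rightarrow> (real ^ 'd) set \<Rightarrow> real" where
  "info_estimate D P Q Su A =
     - (\<Sum>z\<in>UNIV. label_marginal (uniform_measure D A) P z
                      * ln (label_marginal (uniform_measure D A) P z))
     + pool_average Su A (\<lambda>s. \<Sum>z\<in>UNIV. pmf (Q s) z * ln (pmf (Q s) z))"

text \<open>
  "Sufficiently many unlabeled samples": over each cell, the pool averages agree with the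
  corresponding expectations up to \<open>\<eta>\<close>, both for the divergence of Q from P and for the
  average of log Q that enters \<^const>\<open>info_estimate\<close>. The second clause is indispensable: if Q = P,
  the first holds for every pool and does not constrain \<^const>\<open>info_estimate\<close> at all.
\<close>

definition sufficient_pool ::
  "(real ^ 'd) measure \<Rightarrow> 'd kernel \<Rightarrow> 'd kernel \<Rightarrow> (real ^ 'd) set set \<Rightarrow> real \<Rightarrow>
     (real ^ 'd) set \<Rightarrow> bool" where
  "sufficient_pool D P Q \<P> \<eta> Su \<longleftrightarrow>
     finite Su \<and>
     (\<forall>A\<in>\<P>. A \<inter> Su \<noteq> {} \<and>
        \<bar>pool_average Su A (\<lambda>s. measure_pmf.expectation (Q s) (\<lambda>z. ln (pmf (Q s) z / pmf (P s) z)))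
           - cond_KL D Q P A\<bar> \<le> \<eta> \<and>
        \<bar>pool_average Su A (\<lambda>s. measure_pmf.expectation (Q s) (\<lambda>z. ln (pmf (Q s) z)))
           - (\<integral>(s, z). ln (pmf (Q s) z) \<partial>joint (uniform_measure D A) Q)\<bar> \<le> \<eta>)"

definition selected_region ::
  "(real ^ 'd) measure \<Rightarrow> 'd kernel \<Rightarrow> 'd kernel \<Rightarrow> (real ^ 'd) set set \<Rightarrow> (real ^ 'd) set \<Rightarrow>
     (real ^ 'd) set \<Rightarrow> bool" where
  "selected_region D P Q \<P> Su A \<longleftrightarrow> is_arg_max (info_estimate D P Q Su) (\<lambda>A. A \<in> \<P>) A"


subsection \<open>The sequential test and its power\<close>

text \<open>
  \<open>\<omega> i\<close> is the (i+1)-st labeled pair. The pairs are i.i.d. from the joint law given by \<open>D\<close> and P;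
  the baseline test is run with \<open>D\<close> itself, the partition-based active test with
  \<open>uniform_measure D A\<close> for a selected region A.
\<close>

definition sample_space :: "(real ^ 'd) measure \<Rightarrow> 'd kernel \<Rightarrow> (nat \<Rightarrow> (real ^ 'd) \<times> bool) measure" where
  "sample_space D P = PiM UNIV (\<lambda>_. joint D P)"

definition statistic ::
  "(real ^ 'd) measure \<Rightarrow> 'd kernel \<Rightarrow> 'd kernel \<Rightarrow> (nat \<Rightarrow> (real ^ 'd) \<times> bool) \<Rightarrow> nat \<Rightarrow> real" where
  "statistic D P Q \<omega> n = (\<Prod>i<n. label_marginal D P (snd (\<omega> i)) / pmf (Q (fst (\<omega> i))) (snd (\<omega> i)))"

definition test_power ::
  "(real ^ 'd) measure \<Rightarrow> 'd kernel \<Rightarrow> 'd kernel \<Rightarrow> nat \<Rightarrow> real \<Rightarrow> real" where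
  "test_power D P Q Nq \<alpha> =
     measure (sample_space D P)
       {\<omega> \<in> space (sample_space D P). \<exists>n\<in>{1..Nq}. statistic D P Q \<omega> n \<le> \<alpha>}"


subsection \<open>Normal approximation\<close>

definition Phi :: "real \<Rightarrow> real" where
  "Phi = cdf std_normal_distribution"

text \<open>The normal law with mean \<open>m\<close> and standard deviation \<open>s\<close>; for \<open>s = 0\<close> it is the point mass at \<open>m\<close>.\<close>

definition normal_law :: "real \<Rightarrow> real \<Rightarrow> real measure" where
  "normal_law m s = (if s = 0 then return borel m else density lborel (normal_density m s))"

definition llr :: "(real ^ 'd) measure \<Rightarrow> 'd kernel \<Rightarrow> 'd kernel \<Rightarrow> (real ^ 'd) \<times> bool \<Rightarrow> real" where
  "llr D P Q = (\<lambda>(s, z). ln (label_marginal D P z / pmf (Q s) z))"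

text \<open>
  Error of the central-limit approximation: the sup-distance between the distribution function
  of the mean of \<open>Nq\<close> log-ratios and that of the normal law with the same mean and variance.
\<close>

definition clt_error :: "(real ^ 'd) measure \<Rightarrow> 'd kernel \<Rightarrow> 'd kernel \<Rightarrow> nat \<Rightarrow> real" where
  "clt_error D P Q Nq =
     (SUP x. \<bar>measure (sample_space D P)
                {\<omega> \<in> space (sample_space D P). (\<Sum>i<Nq. llr D P Q (\<omega> i)) / real Nq \<le> x}
              - cdf (normal_law (\<integral>y. llr D P Q y \<partial>joint D P)
                       (sqrt (var (joint D P) (llr D P Q) / real Nq))) x\<bar>)"

text \<open>
  "The test has power approximately at least \<open>Phi (b Nq \<alpha>)\<close>". The error committed is an
  error of normal approximation, which vanishes as \<open>Nq\<close> grows. It is at most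
  \<^const>\<open>clt_error\<close>, uniformly in \<open>\<alpha>\<close>, whenever \<open>b Nq \<alpha> \<ge> 0\<close>. For \<open>b Nq \<alpha> < 0\<close> replacing the
  variance of the log-ratio by an upper bound increases the value of \<^const>\<open>Phi\<close>, so that the
  inequality with this error can fail; there the comparison is asymptotic, for each fixed \<open>\<alpha>\<close>.
\<close>

definition power_approx_at_least ::
  "(real ^ 'd) measure \<Rightarrow> 'd kernel \<Rightarrow> 'd kernel \<Rightarrow> (nat \<Rightarrow> real \<Rightarrow> real) \<Rightarrow> bool" where
  "power_approx_at_least D P Q b \<longleftrightarrow>
     clt_error D P Q \<longlonglongrightarrow> 0 \<and>
     (\<forall>\<alpha>. 0 < \<alpha> \<longrightarrow> \<alpha> < 1 \<longrightarrow>
        (\<exists>\<delta>. \<delta> \<longlonglongrightarrow> 0 \<and>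
          (\<forall>Nq\<ge>1. test_power D P Q Nq \<alpha> \<ge> Phi (b Nq \<alpha>) - \<delta> Nq \<and>
                   (b Nq \<alpha> \<ge> 0 \<longrightarrow> \<delta> Nq \<le> clt_error D P Q Nq))))"

end

theory Submission
  imports Defs
begin

text \<open>
  Since \<open>w\<^bsub>Nq\<^esub> \<le> \<alpha>\<close> entails rejection, the power is at least the probability that the mean of \<open>Nq\<close> i.i.d.
  log-ratios \<open>ln (P(z) / Q(z|s))\<close> is at most \<open>ln \<alpha> / Nq\<close>, and the central limit theorem, uniform by
  Polya's theorem, evaluates this. The mean of the log-ratio is \<open>- I(S;Z) + KL(P\<parallel>Q)\<close> with
  \<open>KL(P\<parallel>Q) \<le> sqrt \<epsilon>1\<close>, and Minkowski's inequality bounds its standard deviation by \<open>\<sigma> + sqrt \<epsilon>1\<close>.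

  For an accurate pool the selected region maximises \<open>H(Z|A) - h(Q|A)\<close> instead of
  \<open>I(S;Z|A) = H(Z|A) - h(P|A)\<close>, where \<open>h\<close> denotes the conditional label entropy. For two labels
  \<open>h(P) - h(Q)\<close> is at most the \<open>L\<^sup>2(P)\<close>-norm of \<open>ln (Q/P)\<close>, so the replacement costs \<open>sqrt \<epsilon>2\<close> in the
  most informative region and \<open>sqrt \<epsilon>1\<close> in the selected one.

  Let \<open>c\<close> be the resulting lower bound for minus the mean. If \<open>c\<close> is positive or negative, the argument of \<^const>\<open>Phi\<close> is eventually nonnegative or
  tends to \<open>-\<infinity>\<close>. If \<open>c = 0\<close>, the only obstacle is a log-ratio that vanishes almost surely; then all the
  inequalities are equalities, which forces \<open>P = Q\<close> and hence \<open>I(S;Z) = 0\<close>, contradicting \<open>H1\<close>.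
\<close>

subsection \<open>Entropy of a two-point distribution\<close>

text \<open>With \<open>t\<close> the fourth root of \<open>x\<close> and u = 1/t,
  \<open>- ln x\<close> is 4 ln u, and 4 ln u \<le> 4 (u - 1) \<le> u^2. The fourth root makes the
  last inequality the perfect square (u - 2)^2 \<ge> 0.\<close>

lemma neg_ln_le_inverse_sqrt:
  fixes x :: real
  assumes "0 < x"
  shows "- ln x \<le> 1 / sqrt x"
proof -
  define t where "t = sqrt (sqrt x)"
  have t: "t > 0" "t\<^sup>2 = sqrt x" "x = t ^ 4"
    using assms power_mult[of t 2 2] by (auto simp: t_def)
  have "- ln x = 4 * ln (1 / t)"
    using t by (simp add: ln_realpow ln_div)
  also have "\<dots> \<le> 4 * (1 / t - 1)"
    using ln_le_minus_one[of "1 / t"] t by simp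
  also have "\<dots> \<le> (1 / t)\<^sup>2"
    using zero_le_power2[of "1 / t - 2"] by (simp add: power2_diff algebra_simps)
  finally show ?thesis using t by (simp add: power_divide)
qed

definition pmf_entropy :: "bool pmf \<Rightarrow> real" where
  "pmf_entropy \<pi> = - (\<Sum>z\<in>UNIV. pmf \<pi> z * ln (pmf \<pi> z))"

lemma pmf_bool_sum: "(\<Sum>z\<in>UNIV. pmf \<pi> (z::bool)) = 1"
  by (rule sum_pmf_eq_1) auto

text \<open>The function \<open>f\<close> is \<open>sqrt p * ln x\<close> minus the binary entropy
  of \<open>x\<close>, and it is nondecreasing between \<open>q\<close> and \<open>p\<close>: in its
  derivative \<open>sqrt p / x\<close> is at least \<open>1 / sqrt x\<close>, which outweighs
  \<open>ln x\<close>, and \<open>- ln (1 - x)\<close> is nonnegative. The factor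
  \<open>sqrt p\<close> makes the square of the right side one term of an L^2-norm.\<close>

lemma binary_entropy_diff_le:
  fixes p q :: real
  assumes "0 < q" "q \<le> p" "p < 1"
  shows "q * ln q + (1 - q) * ln (1 - q) - (p * ln p + (1 - p) * ln (1 - p)) \<le> sqrt p * ln (p / q)"
proof -
  define f where "f x = sqrt p * ln x + x * ln x + (1 - x) * ln (1 - x)" for x
  have "f q \<le> f p"
  proof (rule DERIV_nonneg_imp_nondecreasing[OF \<open>q \<le> p\<close>])
    fix x assume x: "q \<le> x" "x \<le> p"
    then have x': "0 < x" "x < 1" using assms by auto
    have d: "DERIV f x :> sqrt p / x + ln x - ln (1 - x)"
      unfolding f_def using x' by (auto intro!: derivative_eq_intros simp: divide_simps) (simp add: algebra_simps)
    have "1 / sqrt x = sqrt x / x"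
      using x' by (simp add: real_div_sqrt field_simps)
    also have "\<dots> \<le> sqrt p / x"
      using x x' by (simp add: divide_right_mono)
    finally have "0 \<le> sqrt p / x + ln x - ln (1 - x)"
      using neg_ln_le_inverse_sqrt[OF x'(1)] x' by (smt (verit) ln_le_zero_iff)
    with d show "\<exists>y. DERIV f x :> y \<and> 0 \<le> y" by blast
  qed
  then show ?thesis
    using assms by (simp add: f_def ln_div algebra_simps)
qed

text \<open>One label suffices: both masses add up to 1, so some label has at least as much mass
  under \<pi> as under \<rho>. The squared binary bound at that label is a single summand of the
  nonnegative sum.\<close>

lemma pmf_entropy_diff_le:
  fixes \<pi> \<rho> :: "bool pmf"
  assumes null: "\<And>z. pmf \<pi> z = 0 \<longleftrightarrow> pmf \<rho> z = 0"
  shows "pmf_entropy \<pi> - pmf_entropy \<rho> \<le> sqrt (\<Sum>z\<in>UNIV. pmf \<pi> z * (ln (pmf \<rho> z / pmf \<pi> z))\<^sup>2)"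
proof -
  let ?S = "\<Sum>z\<in>UNIV. pmf \<pi> z * (ln (pmf \<rho> z / pmf \<pi> z))\<^sup>2"
  have S: "0 \<le> ?S" by (intro sum_nonneg) simp
  have compl: "pmf \<pi> (\<not> z) = 1 - pmf \<pi> z" "pmf \<rho> (\<not> z) = 1 - pmf \<rho> z" for z
    using pmf_bool_sum[of \<pi>] pmf_bool_sum[of \<rho>] by (cases z; simp add: UNIV_bool)+
  have ent: "pmf_entropy \<tau> = - (pmf \<tau> z * ln (pmf \<tau> z) + pmf \<tau> (\<not> z) * ln (pmf \<tau> (\<not> z)))" for \<tau> z
    by (cases z) (auto simp: pmf_entropy_def UNIV_bool)
  have *: ?thesis if le: "pmf \<rho> z \<le> pmf \<pi> z" for z
  proof (cases "pmf \<rho> z = 0 \<or> pmf \<pi> z = 1")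
    case True
    \<comment> \<open>Agreement of the zeros makes \<pi> and \<rho> the same point mass, so the left
      side is 0.\<close>
    then have "pmf \<rho> z = 0 \<and> pmf \<pi> z = 0 \<or> pmf \<rho> z = 1 \<and> pmf \<pi> z = 1"
      using null[of z] null[of "\<not> z"] compl[of z] by auto
    then show ?thesis
      unfolding ent[of _ z] compl using S by auto
  next
    case False
    then have *: "0 < pmf \<rho> z" "0 < pmf \<pi> z" "pmf \<pi> z < 1"
      using null[of z] pmf_le_1[of \<pi> z] by (auto simp: less_le)
    have "pmf_entropy \<pi> - pmf_entropy \<rho> \<le> sqrt (pmf \<pi> z) * ln (pmf \<pi> z / pmf \<rho> z)"
      using binary_entropy_diff_le[OF *(1) le *(3)] unfolding ent[of _ z] compl by simp
    also have "\<dots> = sqrt (pmf \<pi> z * (ln (pmf \<rho> z / pmf \<pi> z))\<^sup>2)"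
      using * le by (simp add: real_sqrt_mult ln_div)
    also have "\<dots> \<le> sqrt ?S"
      by (intro real_sqrt_le_mono member_le_sum) auto
    finally show ?thesis .
  qed
  show ?thesis
  proof (cases "pmf \<rho> True \<le> pmf \<pi> True")
    case True
    then show ?thesis by (rule *)
  next
    case False
    then show ?thesis using compl[of True] by (intro *[of False]) simp
  qed
qed

text \<open>This bound and the next keep logarithms of label probabilities, weighted by these
  probabilities, bounded. Entropies and second moments of information are therefore finite for every
  kernel.\<close>

lemma mult_ln_squared_le:
  fixes x :: real
  assumes "0 \<le> x" "x \<le> 1"
  shows "x * (ln x)\<^sup>2 \<le> 1"
proof (cases "x = 0")
  case False
  with assms have x: "0 < x" by simp
  have "0 \<le> - ln x" using x assms by simp
  then have "(- ln x)\<^sup>2 \<le> (1 / sqrt x)\<^sup>2"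
    using neg_ln_le_inverse_sqrt[OF x] by (intro power_mono) auto
  then show ?thesis using x by (simp add: power_divide field_simps)
qed simp

lemma abs_mult_ln_le:
  fixes x :: real
  assumes "0 \<le> x" "x \<le> 1"
  shows "\<bar>x * ln x\<bar> \<le> 1"
proof (cases "x = 0")
  case False
  with assms have x: "0 < x" by simp
  have "0 \<le> - ln x" using x assms by simp
  have "x * - ln x \<le> x * (1 / sqrt x)"
    using neg_ln_le_inverse_sqrt[OF x] x by (intro mult_left_mono) auto
  also have "\<dots> = sqrt x" using x by (simp add: real_div_sqrt)
  finally have "x * - ln x \<le> 1" using assms by (smt (verit) real_sqrt_le_1_iff)
  moreover have "0 \<le> x * - ln x" using \<open>0 \<le> - ln x\<close> x by (intro mult_nonneg_nonneg) auto
  ultimately show ?thesis by simp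
qed simp

text \<open>By ln u \<le> u - 1 each term is at most \<open>p z - pmf \<pi> z\<close>, and these
  differences sum to 0. A zero sum forces equality in every term, hence u = 1. Condition
  \<open>ac\<close> excludes \<open>p z = 0\<close> with positive \<open>pmf \<pi> z\<close>, where
  the default \<open>ln 0 = 0\<close> would stand in for minus infinity.\<close>

lemma gibbs_pmf:
  fixes \<pi> :: "bool pmf" and p :: "bool \<Rightarrow> real"
  assumes p: "\<And>z. 0 \<le> p z" "(\<Sum>z\<in>UNIV. p z) = 1" and ac: "\<And>z. pmf \<pi> z \<noteq> 0 \<Longrightarrow> p z \<noteq> 0"
  shows "(\<Sum>z\<in>UNIV. pmf \<pi> z * ln (p z / pmf \<pi> z)) \<le> 0"
    and "(\<Sum>z\<in>UNIV. pmf \<pi> z * ln (p z / pmf \<pi> z)) = 0 \<Longrightarrow> pmf \<pi> z = p z"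
proof -
  let ?t = "\<lambda>z. pmf \<pi> z * ln (p z / pmf \<pi> z)"
  have le: "?t z \<le> p z - pmf \<pi> z" and eq: "?t z = p z - pmf \<pi> z \<Longrightarrow> pmf \<pi> z = p z" for z
  proof -
    have "?t z \<le> p z - pmf \<pi> z \<and> (?t z = p z - pmf \<pi> z \<longrightarrow> pmf \<pi> z = p z)"
    proof (cases "pmf \<pi> z = 0")
      case False
      then have pos: "0 < pmf \<pi> z" "0 < p z / pmf \<pi> z"
        using ac[of z] p(1)[of z] by (auto simp: less_le)
      have diff: "p z - pmf \<pi> z = pmf \<pi> z * (p z / pmf \<pi> z - 1)"
        using pos by (simp add: field_simps)
      have "?t z \<le> pmf \<pi> z * (p z / pmf \<pi> z - 1)"
        using ln_le_minus_one[OF pos(2)] pos by (intro mult_left_mono) auto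
      moreover have "pmf \<pi> z = p z" if "?t z = pmf \<pi> z * (p z / pmf \<pi> z - 1)"
        using that pos ln_eq_minus_one[OF pos(2)] by simp
      ultimately show ?thesis unfolding diff by blast
    qed (use p in auto)
    then show "?t z \<le> p z - pmf \<pi> z" "?t z = p z - pmf \<pi> z \<Longrightarrow> pmf \<pi> z = p z" by auto
  qed
  have sum0: "(\<Sum>z\<in>UNIV. p z - pmf \<pi> z) = 0"
    by (simp add: sum_subtractf p pmf_bool_sum)
  show "(\<Sum>z\<in>UNIV. ?t z) \<le> 0"
    using sum_mono[of UNIV ?t "\<lambda>z. p z - pmf \<pi> z"] le sum0 by simp
  assume "(\<Sum>z\<in>UNIV. ?t z) = 0"
  then have "(\<Sum>z\<in>UNIV. ?t z) = (\<Sum>z\<in>UNIV. p z - pmf \<pi> z)" using sum0 by simp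
  then have "?t z = p z - pmf \<pi> z"
    using le[of True] le[of False] by (cases z) (auto simp: UNIV_bool)
  then show "pmf \<pi> z = p z" by (rule eq)
qed

subsection \<open>Variance of a sum\<close>

lemma (in prob_space) square_expectation_le:
  fixes X :: "'a \<Rightarrow> real"
  assumes [measurable]: "random_variable borel X" and sq: "integrable M (\<lambda>x. (X x)\<^sup>2)"
  shows "(expectation X)\<^sup>2 \<le> expectation (\<lambda>x. (X x)\<^sup>2)"
proof -
  have "integrable M X"
    by (rule square_integrable_imp_integrable[OF _ sq]) simp
  then show ?thesis
    using variance_eq[of X] variance_positive[of X] sq by simp
qed

lemma (in prob_space) abs_expectation_le_sqrt:
  fixes X :: "'a \<Rightarrow> real"
  assumes "random_variable borel X" "integrable M (\<lambda>x. (X x)\<^sup>2)"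
  shows "\<bar>expectation X\<bar> \<le> sqrt (expectation (\<lambda>x. (X x)\<^sup>2))"
  using square_expectation_le[OF assms] real_le_rsqrt by fastforce

lemma var_le_second_moment:
  fixes X :: "'a \<Rightarrow> real"
  assumes "prob_space M" and [measurable]: "X \<in> borel_measurable M" and sq: "integrable M (\<lambda>x. (X x)\<^sup>2)"
  shows "var M X \<le> (\<integral>x. (X x)\<^sup>2 \<partial>M)"
proof -
  interpret prob_space M by fact
  have "integrable M X"
    by (rule square_integrable_imp_integrable[OF _ sq]) simp
  then show ?thesis
    using variance_eq[of X] sq unfolding var_def by simp
qed

lemma var_nonneg: "0 \<le> var M X"
  by (simp add: var_def)

lemma integrable_sum_square:
  fixes X Y :: "'a \<Rightarrow> real"
  assumes [measurable]: "X \<in> borel_measurable M" "Y \<in> borel_measurable M"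
    and sq: "integrable M (\<lambda>x. (X x)\<^sup>2)" "integrable M (\<lambda>x. (Y x)\<^sup>2)"
  shows "integrable M (\<lambda>x. (X x + Y x)\<^sup>2)"
proof (rule Bochner_Integration.integrable_bound)
  show "integrable M (\<lambda>x. 2 * (X x)\<^sup>2 + 2 * (Y x)\<^sup>2)"
    using sq by simp
  have "(a + b)\<^sup>2 \<le> 2 * a\<^sup>2 + 2 * b\<^sup>2" for a b :: real
    using sum_squares_bound[of a b] by (simp add: power2_sum)
  then show "AE x in M. norm ((X x + Y x)\<^sup>2) \<le> norm (2 * (X x)\<^sup>2 + 2 * (Y x)\<^sup>2)"
    by simp
qed simp

text \<open>Cauchy--Schwarz, by expanding the square of
  \<open>sqrt ?b * X x - sqrt ?a * Y x\<close>. Cancelling \<open>sqrt ?a * sqrt ?b\<close> requires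
  both moments to be positive; otherwise the product vanishes almost everywhere.\<close>

lemma integral_mult_le_sqrt:
  fixes X Y :: "'a \<Rightarrow> real"
  assumes [measurable]: "X \<in> borel_measurable M" "Y \<in> borel_measurable M"
    and sq: "integrable M (\<lambda>x. (X x)\<^sup>2)" "integrable M (\<lambda>x. (Y x)\<^sup>2)"
  shows "integrable M (\<lambda>x. X x * Y x)"
    and "(\<integral>x. X x * Y x \<partial>M) \<le> sqrt (\<integral>x. (X x)\<^sup>2 \<partial>M) * sqrt (\<integral>x. (Y x)\<^sup>2 \<partial>M)"
proof -
  show int: "integrable M (\<lambda>x. X x * Y x)"
  proof (rule Bochner_Integration.integrable_bound)
    show "integrable M (\<lambda>x. (X x)\<^sup>2 + (Y x)\<^sup>2)" using sq by simp
    have "\<bar>a * b\<bar> \<le> a\<^sup>2 + b\<^sup>2" for a b :: real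
      using sum_squares_bound[of "\<bar>a\<bar>" "\<bar>b\<bar>"] mult_nonneg_nonneg[of "\<bar>a\<bar>" "\<bar>b\<bar>"]
      unfolding abs_mult power2_abs by linarith
    then show "AE x in M. norm (X x * Y x) \<le> norm ((X x)\<^sup>2 + (Y x)\<^sup>2)" by simp
  qed simp
  let ?a = "\<integral>x. (X x)\<^sup>2 \<partial>M" and ?b = "\<integral>x. (Y x)\<^sup>2 \<partial>M" and ?c = "\<integral>x. X x * Y x \<partial>M"
  have nn: "0 \<le> ?a" "0 \<le> ?b" by simp_all
  show "?c \<le> sqrt ?a * sqrt ?b"
  proof (cases "?a = 0 \<or> ?b = 0")
    case True
    then have "AE x in M. X x = 0 \<or> Y x = 0"
      using sq by (auto simp: integral_nonneg_eq_0_iff_AE elim: eventually_mono)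
    then have "?c = (\<integral>x. 0 \<partial>M)"
      by (intro integral_cong_AE) auto
    then show ?thesis using nn by simp
  next
    case False
    with nn have pos: "0 < sqrt ?a * sqrt ?b" by (simp add: less_le)
    have "0 \<le> (\<integral>x. (sqrt ?b * X x - sqrt ?a * Y x)\<^sup>2 \<partial>M)" by simp
    also have "\<dots> = (\<integral>x. ?b * (X x)\<^sup>2 + ?a * (Y x)\<^sup>2 - 2 * (sqrt ?a * sqrt ?b) * (X x * Y x) \<partial>M)"
      by (intro Bochner_Integration.integral_cong refl) (simp add: power2_diff power_mult_distrib nn)
    also have "\<dots> = ?b * ?a + ?a * ?b - 2 * (sqrt ?a * sqrt ?b) * ?c"
      using sq int by simp
    finally have "(sqrt ?a * sqrt ?b) * ?c \<le> ?a * ?b" by (simp add: algebra_simps)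
    also have "\<dots> = (sqrt ?a * sqrt ?b) * (sqrt ?a * sqrt ?b)"
      using real_sqrt_pow2[OF nn(1)] real_sqrt_pow2[OF nn(2)] by (metis power_mult_distrib power2_eq_square)
    finally show ?thesis using pos by (rule mult_left_le_imp_le)
  qed
qed

text \<open>Minkowski's inequality for standard deviations, in squared form.\<close>

lemma var_diff_le:
  fixes X Y :: "'a \<Rightarrow> real"
  assumes M: "prob_space M" and [measurable]: "X \<in> borel_measurable M" "Y \<in> borel_measurable M"
    and sq: "integrable M (\<lambda>x. (X x)\<^sup>2)" "integrable M (\<lambda>x. (Y x)\<^sup>2)"
  shows "var M (\<lambda>x. X x - Y x) \<le> var M X + var M Y + 2 * sqrt (var M X) * sqrt (var M Y)"
proof -
  interpret prob_space M by fact
  have int: "integrable M X" "integrable M Y"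
    using square_integrable_imp_integrable[OF _ sq(1)] square_integrable_imp_integrable[OF _ sq(2)] by simp_all
  \<comment> \<open>\<open>?Y\<close> is centred with reversed sign, so that \<open>?X + ?Y\<close>
    is the centred \<open>X - Y\<close> and the cross term has the sign that Cauchy--Schwarz
    bounds.\<close>
  let ?X = "\<lambda>x. X x - expectation X" and ?Y = "\<lambda>x. expectation Y - Y x"
  have csq: "integrable M (\<lambda>x. (?X x)\<^sup>2)" "integrable M (\<lambda>x. (?Y x)\<^sup>2)"
    using int sq by (auto simp: power2_diff)
  note CS = integral_mult_le_sqrt[OF _ _ csq]
  have "var M (\<lambda>x. X x - Y x) = (\<integral>x. (?X x)\<^sup>2 + (?Y x)\<^sup>2 + 2 * (?X x * ?Y x) \<partial>M)"
    unfolding var_def using int by (intro Bochner_Integration.integral_cong refl) (simp add: power2_eq_square algebra_simps)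
  also have "\<dots> = var M X + var M Y + 2 * (\<integral>x. ?X x * ?Y x \<partial>M)"
    using csq CS(1) by (simp add: var_def power2_commute[of "expectation Y"])
  also have "\<dots> \<le> var M X + var M Y + 2 * (sqrt (var M X) * sqrt (var M Y))"
    using CS(2) by (simp add: var_def power2_commute[of "expectation Y"])
  finally show ?thesis by simp
qed

subsection \<open>Uniform central limit theorem\<close>

text \<open>Polya's theorem. Continuity provides points \<open>y i\<close> at which the limit takes
  exactly the levels i/k. Convergence at these finitely many points is simultaneous, and between
  them monotonicity confines \<open>F n\<close> up to \<epsilon>/2 + 1/k.\<close>

lemma (in real_distribution) uniform_cdf_convergence:
  assumes cont: "\<And>x. isCont (cdf M) x"
    and F: "\<And>x. (\<lambda>n. F n x) \<longlonglongrightarrow> cdf M x"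
    and mono: "\<And>n x y. x \<le> y \<Longrightarrow> F n x \<le> F n y"
    and bnd: "\<And>n x. 0 \<le> F n x" "\<And>n x. F n x \<le> 1"
    and "0 < \<epsilon>"
  shows "\<forall>\<^sub>F n in sequentially. \<forall>x. \<bar>F n x - cdf M x\<bar> \<le> \<epsilon>"
proof -
  obtain k :: nat where k: "0 < k" "1 / real k < \<epsilon> / 2"
    using reals_Archimedean[of "\<epsilon> / 2"] \<open>0 < \<epsilon>\<close>
    by (metis divide_inverse half_gt_zero mult_1 zero_less_Suc)
  have "\<exists>y. cdf M y = real i / real k" if i: "0 < i" "i < k" for i
  proof -
    have "\<forall>\<^sub>F x in at_bot. cdf M x < real i / real k"
      using cdf_lim_at_bot by (rule order_tendstoD) (use i in auto)
    then obtain a where a: "cdf M a < real i / real k"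
      by (auto simp: eventually_at_bot_linorder)
    have "\<forall>\<^sub>F x in at_top. cdf M x > real i / real k"
      using cdf_lim_at_top_prob by (rule order_tendstoD) (use i in auto)
    then obtain b where b: "cdf M b > real i / real k"
      by (auto simp: eventually_at_top_linorder)
    have "a \<le> b" using a b cdf_nondecreasing[of b a] by linarith
    then show ?thesis
      using IVT'[of "cdf M" a "real i / real k" b] a b cont
      by (auto intro: continuous_at_imp_continuous_on)
  qed
  then obtain y where y: "\<And>i. 0 < i \<Longrightarrow> i < k \<Longrightarrow> cdf M (y i) = real i / real k"
    by metis
  have "\<forall>\<^sub>F n in sequentially. \<forall>i\<in>{0<..<k}. \<bar>F n (y i) - cdf M (y i)\<bar> < \<epsilon> / 2"
  proof (intro eventually_ball_finite ballI)
    fix i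
    show "\<forall>\<^sub>F n in sequentially. \<bar>F n (y i) - cdf M (y i)\<bar> < \<epsilon> / 2"
      using tendstoD[OF F, of "\<epsilon> / 2" "y i"] \<open>0 < \<epsilon>\<close> by (simp add: dist_real_def)
  qed simp
  then show ?thesis
  proof eventually_elim
    case (elim n)
    show ?case
    proof
      fix x
      let ?c = "cdf M x"
      have c: "0 \<le> ?c" "?c \<le> 1" by (auto simp: cdf_nonneg cdf_bounded_prob)
      \<comment> \<open>\<open>i\<close> and \<open>j\<close> are the nearest grid indices strictly
        below and strictly above \<open>real k * ?c\<close>. Strictness orders \<open>y i\<close>,
        \<open>x\<close> and \<open>y j\<close> even where \<open>cdf M\<close> is flat. If there is
        no inner level on one side, \<open>?c\<close> is within 1/k of 0 or 1 and the trivial bounds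
        on \<open>F\<close> suffice.\<close>
      define i where "i = nat (\<lceil>real k * ?c\<rceil> - 1)"
      define j where "j = nat (\<lfloor>real k * ?c\<rfloor> + 1)"
      have kc: "0 \<le> real k * ?c" "real k * ?c \<le> real k"
        using c k by (auto simp: mult_left_le)
      have "?c - \<epsilon> \<le> F n x"
      proof (cases "0 < i")
        case True
        then have ri: "real i < real k * ?c" "real k * ?c \<le> real i + 1"
          unfolding i_def by linarith+
        then have "i < k" using kc by linarith
        have "cdf M (y i) < ?c" "?c \<le> cdf M (y i) + 1 / real k"
          using ri k unfolding y[OF True \<open>i < k\<close>] by (simp_all add: field_simps)
        then have "y i \<le> x" using cdf_nondecreasing[of x "y i"] by linarith
        then have "F n (y i) \<le> F n x" by (rule mono)
        moreover have "\<bar>F n (y i) - cdf M (y i)\<bar> < \<epsilon> / 2" using elim True \<open>i < k\<close> by auto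
        ultimately show ?thesis using \<open>?c \<le> cdf M (y i) + 1 / real k\<close> k by linarith
      next
        case False
        then have "real k * ?c \<le> 1" unfolding i_def by linarith
        then have "?c \<le> 1 / real k" using k by (simp add: field_simps)
        then show ?thesis using bnd(1)[of n x] k \<open>0 < \<epsilon>\<close> by linarith
      qed
      moreover have "F n x \<le> ?c + \<epsilon>"
      proof (cases "j < k")
        case True
        have rj: "real k * ?c < real j" "real j \<le> real k * ?c + 1"
          unfolding j_def using kc by linarith+
        then have "0 < j" using kc by linarith
        have "?c < cdf M (y j)" "cdf M (y j) \<le> ?c + 1 / real k"
          using rj k unfolding y[OF \<open>0 < j\<close> True] by (simp_all add: field_simps)
        then have "x \<le> y j" using cdf_nondecreasing[of "y j" x] by linarith
        then have "F n x \<le> F n (y j)" by (rule mono)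
        moreover have "\<bar>F n (y j) - cdf M (y j)\<bar> < \<epsilon> / 2" using elim True \<open>0 < j\<close> by auto
        ultimately show ?thesis using \<open>cdf M (y j) \<le> ?c + 1 / real k\<close> k by linarith
      next
        case False
        then have "real k \<le> real k * ?c + 1" unfolding j_def using kc by linarith
        then have "1 \<le> ?c + 1 / real k" using k by (simp add: field_simps)
        then show ?thesis using bnd(2)[of n x] k \<open>0 < \<epsilon>\<close> by linarith
      qed
      ultimately show "\<bar>F n x - ?c\<bar> \<le> \<epsilon>" by linarith
    qed
  qed
qed

section \<open>The standard normal distribution function and normal laws\<close>

lemma isCont_Phi: "isCont Phi x"
proof -
  interpret real_distribution std_normal_distribution by (rule real_dist_normal_dist)
  have "emeasure std_normal_distribution {x} = 0"
    by (subst emeasure_density) (auto simp: nn_integral_cmult_indicator[symmetric] 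
      intro!: nn_integral_0_iff_AE[THEN iffD2] AE_I'[of "{x}"] split: split_indicator)
  then show ?thesis unfolding Phi_def isCont_cdf by (simp add: measure_def)
qed

lemma Phi_mono: "x \<le> y \<Longrightarrow> Phi x \<le> Phi y"
  using finite_borel_measure.cdf_nondecreasing[OF real_distribution.finite_borel_measure_M[OF real_dist_normal_dist]]
  by (simp add: Phi_def)

lemma Phi_nonneg: "0 \<le> Phi x"
  by (simp add: Phi_def cdf_def)

lemma Phi_le_1: "Phi x \<le> 1"
  using real_distribution.cdf_bounded_prob[OF real_dist_normal_dist] by (simp add: Phi_def)

lemma Phi_at_bot: "(Phi \<longlongrightarrow> 0) at_bot"
  using finite_borel_measure.cdf_lim_at_bot[OF real_distribution.finite_borel_measure_M[OF real_dist_normal_dist]]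
  by (simp add: Phi_def[abs_def])

lemma cdf_normal_law:
  assumes "0 < s"
  shows "cdf (normal_law m s) x = Phi ((x - m) / s)"
proof -
  let ?N = "density lborel (normal_density m s)"
  interpret prob_space ?N using assms by (rule prob_space_normal_density)
  have "distributed ?N lborel (\<lambda>x. x) (normal_density m s)"
    by (auto simp: distributed_def distr_id2)
  then have "distributed ?N lborel (\<lambda>x. (x - m) / s) std_normal_density"
    using normal_standard_normal_convert[OF assms] by simp
  then have eq: "distr ?N lborel (\<lambda>x. (x - m) / s) = std_normal_distribution"
    by (simp add: distributed_def)
  have "Phi ((x - m) / s) = measure (distr ?N lborel (\<lambda>x. (x - m) / s)) {..(x - m) / s}"
    by (simp add: Phi_def cdf_def eq)
  also have "\<dots> = measure ?N ((\<lambda>x. (x - m) / s) -` {..(x - m) / s} \<inter> space ?N)"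
    by (rule measure_distr) auto
  also have "(\<lambda>x. (x - m) / s) -` {..(x - m) / s} \<inter> space ?N = {..x}"
    using assms by (auto simp: divide_le_cancel)
  finally show ?thesis using assms by (simp add: normal_law_def cdf_def)
qed

lemma cdf_normal_law_0: "cdf (normal_law m 0) x = (if m \<le> x then 1 else 0)"
  by (simp add: normal_law_def cdf_def measure_return indicator_def)

lemma indep_vars_coordinates:
  assumes M: "prob_space M"
  shows "prob_space.indep_vars (PiM UNIV (\<lambda>_::nat. M)) (\<lambda>_. M) (\<lambda>i \<omega>. \<omega> i) UNIV"
proof -
  interpret M: prob_space M by fact
  interpret PP: product_prob_space "\<lambda>_::nat. M" UNIV ..
  have "prob_space (PiM UNIV (\<lambda>_::nat. M))" by (rule prob_space_PiM) (rule M)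
  then show ?thesis
    by (subst prob_space.indep_vars_iff_distr_eq_PiM) (auto simp: PP.PiM_component distr_id2 space_PiM restrict_UNIV)
qed

text \<open>For positive variance, the central limit theorem and Polya's theorem control the
  standardised sums uniformly, and standardising the threshold carries this over to the means. For
  zero variance both distribution functions are the step at the mean, so the distance is 0 for every
  positive \<open>n\<close>.\<close>

lemma clt_uniform:
  fixes X :: "'a \<Rightarrow> real"
  assumes M: "prob_space M" and X [measurable]: "X \<in> borel_measurable M"
    and sq: "integrable M (\<lambda>x. (X x)\<^sup>2)"
  defines "\<Omega> \<equiv> PiM UNIV (\<lambda>_::nat. M)"
  shows "(\<lambda>n. SUP x. \<bar>measure \<Omega> {\<omega> \<in> space \<Omega>. (\<Sum>i<n. X (\<omega> i)) / real n \<le> x}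
              - cdf (normal_law (\<integral>y. X y \<partial>M) (sqrt (var M X / real n))) x\<bar>) \<longlonglongrightarrow> 0"
    (is "(\<lambda>n. SUP x. ?d n x) \<longlonglongrightarrow> 0")
proof -
  interpret M: prob_space M by fact
  interpret PP: product_prob_space "\<lambda>_::nat. M" UNIV ..
  interpret \<Omega>: prob_space \<Omega>
    unfolding \<Omega>_def by (rule prob_space_PiM) (rule M)
  have coord [measurable]: "(\<lambda>\<omega>. \<omega> i) \<in> measurable \<Omega> M" for i
    unfolding \<Omega>_def by simp
  have distr_coord: "distr \<Omega> M (\<lambda>\<omega>. \<omega> i) = M" for i
    unfolding \<Omega>_def using PP.PiM_component[of i] by simp
  define \<mu> where "\<mu> = M.expectation X"
  have int: "integrable M X"
    by (rule M.square_integrable_imp_integrable[OF _ sq]) simp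
  have bound: "\<forall>\<^sub>F n in sequentially. \<forall>x. ?d n x \<le> \<epsilon>" if "0 < \<epsilon>" for \<epsilon>
  proof (cases "var M X = 0")
    case True
    have "integrable M (\<lambda>x. (X x - \<mu>)\<^sup>2)"
      using int sq by (simp add: power2_diff)
    then have AE_M: "AE x in M. X x = \<mu>"
      using integral_nonneg_eq_0_iff_AE[of M "\<lambda>x. (X x - \<mu>)\<^sup>2"] True
      unfolding var_def \<mu>_def[symmetric] by auto
    have "AE \<omega> in \<Omega>. X (\<omega> i) = \<mu>" for i
      unfolding \<Omega>_def
      by (rule AE_PiM_component[of UNIV "\<lambda>_. M" i "\<lambda>x. X x = \<mu>", OF M UNIV_I AE_M])
    then have AE: "AE \<omega> in \<Omega>. \<forall>i. X (\<omega> i) = \<mu>"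
      by (simp add: AE_all_countable)
    have "?d n x = 0" if "0 < n" for n x
    proof -
      have "measure \<Omega> {\<omega> \<in> space \<Omega>. (\<Sum>i<n. X (\<omega> i)) / real n \<le> x} = measure \<Omega> {\<omega> \<in> space \<Omega>. \<mu> \<le> x}"
        using AE that by (intro \<Omega>.finite_measure_eq_AE) (auto elim: eventually_mono)
      also have "\<dots> = cdf (normal_law \<mu> 0) x"
        by (simp add: cdf_normal_law_0 \<Omega>.prob_space)
      finally show ?thesis by (simp add: True \<mu>_def)
    qed
    then show ?thesis
      using that by (intro eventually_mono[OF eventually_gt_at_top[of 0]]) auto
  next
    case False
    define v where "v = var M X"
    have v: "0 < v" using False var_nonneg[of M X] by (simp add: v_def)
    let ?S = "\<lambda>n \<omega>. (\<Sum>i<n. X (\<omega> i) - \<mu>) / sqrt (real n * v)"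
    have mean: "\<Omega>.expectation (\<lambda>\<omega>. f (\<omega> i)) = M.expectation f"
      if [measurable]: "f \<in> borel_measurable M" for f :: "'a \<Rightarrow> real" and i
      using integral_distr[OF coord that, of i] by (simp add: distr_coord)
    have "weak_conv_m (\<lambda>n. distr \<Omega> borel (\<lambda>\<omega>. (\<Sum>i<n. X (\<omega> i) - \<mu>) / sqrt (real n * (sqrt v)\<^sup>2))) std_normal_distribution"
    proof (rule \<Omega>.central_limit_theorem[where \<mu> = "distr M borel X"])
      show "\<Omega>.indep_vars (\<lambda>i. borel) (\<lambda>i \<omega>. X (\<omega> i)) UNIV"
        using indep_vars_coordinates[OF M] unfolding \<Omega>_def[symmetric]
        by (rule \<Omega>.indep_vars_compose2) simp
      show "\<Omega>.expectation (\<lambda>\<omega>. X (\<omega> n)) = \<mu>" for n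
        by (subst mean) (auto simp: \<mu>_def)
      show "0 < sqrt v" using v by simp
      show "integrable \<Omega> (\<lambda>\<omega>. (X (\<omega> n))\<^sup>2)" for n
        using integrable_distr[OF coord[of n], of "\<lambda>x. (X x)\<^sup>2"] sq by (simp add: distr_coord)
      show "\<Omega>.variance (\<lambda>\<omega>. X (\<omega> n)) = (sqrt v)\<^sup>2" for n
        using v by (subst mean, simp, subst mean) (auto simp: v_def var_def)
      show "distr \<Omega> borel (\<lambda>\<omega>. X (\<omega> n)) = distr M borel X" for n
        using distr_distr[OF X coord[of n]] by (simp add: distr_coord comp_def)
    qed
    then have "weak_conv_m (\<lambda>n. distr \<Omega> borel (?S n)) std_normal_distribution"
      using v by simp
    then have conv: "(\<lambda>n. cdf (distr \<Omega> borel (?S n)) x) \<longlonglongrightarrow> cdf std_normal_distribution x" for x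
      using isCont_Phi[of x] unfolding Phi_def by (simp add: weak_conv_m_def weak_conv_def)
    interpret N: real_distribution std_normal_distribution by (rule real_dist_normal_dist)
    have rd: "real_distribution (distr \<Omega> borel (?S n))" for n
      by (intro \<Omega>.real_distribution_distr) simp
    have "\<forall>\<^sub>F n in sequentially. \<forall>x. \<bar>cdf (distr \<Omega> borel (?S n)) x - cdf std_normal_distribution x\<bar> \<le> \<epsilon>"
    proof (rule N.uniform_cdf_convergence)
      show "isCont (cdf std_normal_distribution) x" for x
        using isCont_Phi[of x] by (simp add: Phi_def)
      show "cdf (distr \<Omega> borel (?S n)) x \<le> cdf (distr \<Omega> borel (?S n)) y" if "x \<le> y" for n x y
        using finite_borel_measure.cdf_nondecreasing[OF real_distribution.finite_borel_measure_M[OF rd] that] .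
      show "cdf (distr \<Omega> borel (?S n)) x \<le> 1" for n x
        by (rule real_distribution.cdf_bounded_prob[OF rd])
    qed (use conv \<open>0 < \<epsilon>\<close> in \<open>auto simp: cdf_def\<close>)
    then show ?thesis
      using eventually_gt_at_top[of 0]
    proof eventually_elim
      case (elim n)
      show ?case
      proof
        fix x
        \<comment> \<open>The threshold \<open>x\<close> in standard units. The event for the mean
          at \<open>x\<close> is the event for \<open>?S n\<close> at \<open>y\<close>, so
          uniformity in \<open>y\<close> gives uniformity in \<open>x\<close>.\<close>
        define y where "y = (x - \<mu>) / sqrt (v / real n)"
        have n: "0 < real n" using elim by simp
        have nv: "0 < real n * v" using n v by simp
        have "(\<Sum>i<n. X (\<omega> i)) / real n \<le> x \<longleftrightarrow> ?S n \<omega> \<le> y" for \<omega>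
        proof -
          have "y = (x - \<mu>) * real n / sqrt (real n * v)"
            using n v by (simp add: y_def real_sqrt_divide real_sqrt_mult field_simps)
          then have "?S n \<omega> \<le> y \<longleftrightarrow> (\<Sum>i<n. X (\<omega> i) - \<mu>) \<le> (x - \<mu>) * real n"
            using nv by (auto simp: divide_le_cancel)
          then show ?thesis using n by (simp add: sum_subtractf pos_divide_le_eq algebra_simps)
        qed
        then have "measure \<Omega> {\<omega> \<in> space \<Omega>. (\<Sum>i<n. X (\<omega> i)) / real n \<le> x} = cdf (distr \<Omega> borel (?S n)) y"
          unfolding cdf_def by (subst measure_distr) (auto intro!: arg_cong[where f="measure \<Omega>"])
        moreover have "cdf (normal_law \<mu> (sqrt (v / real n))) x = cdf std_normal_distribution y"
          using n v by (subst cdf_normal_law) (auto simp: y_def Phi_def)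
        ultimately show "?d n x \<le> \<epsilon>"
          using elim(1)[rule_format, of y] by (simp add: \<mu>_def v_def)
      qed
    qed
  qed
  show ?thesis
  proof (rule tendstoI)
    fix e :: real assume "0 < e"
    then have "\<forall>\<^sub>F n in sequentially. \<forall>x. ?d n x \<le> e / 2" by (intro bound) simp
    then show "\<forall>\<^sub>F n in sequentially. dist (SUP x. ?d n x) 0 < e"
    proof eventually_elim
      case (elim n)
      then have "(SUP x. ?d n x) \<le> e / 2" by (intro cSUP_least) auto
      \<comment> \<open>A real supremum is meaningful only for a bounded family, so even this half
        rests on the bound \<open>e / 2\<close>.\<close>
      moreover have "0 \<le> (SUP x. ?d n x)"
        using elim by (intro cSUP_upper2[where x = 0] bdd_aboveI2[where M = "e / 2"]) auto
      ultimately show ?case using \<open>0 < e\<close> by (simp add: dist_real_def)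
    qed
  qed
qed

text \<open>Each deviation is at most the supremum of all of them; the family is bounded because
  both functions take values in [0, 1].\<close>

lemma clt_deviation_le:
  fixes X :: "'a \<Rightarrow> real"
  assumes M: "prob_space M"
  defines "\<Omega> \<equiv> PiM UNIV (\<lambda>_::nat. M)"
  shows "cdf (normal_law (\<integral>y. X y \<partial>M) (sqrt (var M X / real n))) x
     - (SUP x. \<bar>measure \<Omega> {\<omega> \<in> space \<Omega>. (\<Sum>i<n. X (\<omega> i)) / real n \<le> x}
              - cdf (normal_law (\<integral>y. X y \<partial>M) (sqrt (var M X / real n))) x\<bar>)
     \<le> measure \<Omega> {\<omega> \<in> space \<Omega>. (\<Sum>i<n. X (\<omega> i)) / real n \<le> x}" (is "?c x - (SUP x. \<bar>?F x - ?c x\<bar>) \<le> ?F x")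
proof -
  interpret \<Omega>: prob_space \<Omega>
    unfolding \<Omega>_def by (rule prob_space_PiM) (rule M)
  have c: "0 \<le> ?c y \<and> ?c y \<le> 1" for y
  proof -
    have "0 \<le> cdf (normal_law m s) y \<and> cdf (normal_law m s) y \<le> 1" if "0 \<le> s" for m s
      using that by (cases "s = 0") (simp_all add: cdf_normal_law cdf_normal_law_0 Phi_nonneg Phi_le_1)
    then show ?thesis using var_nonneg[of M X] by simp
  qed
  have "\<bar>?F y - ?c y\<bar> \<le> 1" for y
    using c[of y] \<Omega>.prob_le_1 measure_nonneg by (smt (verit))
  then have "\<bar>?F x - ?c x\<bar> \<le> (SUP x. \<bar>?F x - ?c x\<bar>)"
    by (intro cSUP_upper bdd_aboveI2) auto
  then show ?thesis by linarith
qed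

subsection \<open>Mutual information of features and labels\<close>

text \<open>Serves the whole feature law as well as its restriction to a cell, each with the true
  kernel or with the predictor as \<open>K\<close>.\<close>

locale labelled = prob_space D for D :: "(real ^ 'd) measure" +
  fixes K :: "'d kernel"
  assumes sets_D [measurable_cong, simp]: "sets D = sets borel"
    and kernel_measurable [measurable]: "\<And>z. (\<lambda>s. pmf (K s) z) \<in> borel_measurable borel"
begin

sublocale pair: pair_sigma_finite D "count_space (UNIV :: bool set)"
  by (intro pair_sigma_finite.intro sigma_finite_measure_count_space_finite) (unfold_locales, auto)

lemma space_D [simp]: "space D = UNIV"
  using sets_eq_imp_space_eq[OF sets_D] by simp

text \<open>There are only two labels, so measurability on the product can be checked on each label
  slice.\<close>

lemma measurable_pair_bool:
  fixes f :: "(real ^ 'd) \<times> bool \<Rightarrow> 'b"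
  assumes "\<And>z. (\<lambda>s. f (s, z)) \<in> measurable borel N"
  shows "f \<in> measurable (borel \<Otimes>\<^sub>M count_space UNIV) N"
proof -
  have "(\<lambda>x. f (fst x, snd x)) \<in> measurable (borel \<Otimes>\<^sub>M count_space UNIV) N"
    by (rule measurable_compose_countable[where f="\<lambda>z x. f (fst x, z)" and g=snd])
       (use measurable_compose[OF measurable_fst assms] in auto)
  then show ?thesis by simp
qed

lemma measurable_pmf_pair [measurable]:
  "(\<lambda>x. pmf (K (fst x)) (snd x)) \<in> borel_measurable (borel \<Otimes>\<^sub>M count_space UNIV)"
  by (rule measurable_pair_bool) simp

lemma sets_joint [measurable_cong, simp]: "sets (joint D K) = sets (borel \<Otimes>\<^sub>M count_space UNIV)"
  unfolding joint_def by (simp add: sets_pair_measure_cong)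

lemma space_joint [simp]: "space (joint D K) = UNIV"
  unfolding joint_def by (simp add: space_pair_measure)

lemma joint_eq: "joint D K = density (D \<Otimes>\<^sub>M count_space UNIV) (\<lambda>x. ennreal (pmf (K (fst x)) (snd x)))"
  unfolding joint_def by (simp add: case_prod_beta')

lemma nn_integral_joint:
  assumes [measurable]: "f \<in> borel_measurable (borel \<Otimes>\<^sub>M count_space UNIV)"
  shows "(\<integral>\<^sup>+x. f x \<partial>joint D K) = (\<integral>\<^sup>+s. (\<Sum>z\<in>UNIV. ennreal (pmf (K s) z) * f (s, z)) \<partial>D)"
proof -
  have "(\<integral>\<^sup>+x. f x \<partial>joint D K) = (\<integral>\<^sup>+x. ennreal (pmf (K (fst x)) (snd x)) * f x \<partial>(D \<Otimes>\<^sub>M count_space UNIV))"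
    unfolding joint_eq by (rule nn_integral_density) auto
  also have "\<dots> = (\<integral>\<^sup>+s. \<integral>\<^sup>+z. ennreal (pmf (K s) z) * f (s, z) \<partial>count_space UNIV \<partial>D)"
    by (subst pair.M2.nn_integral_fst[symmetric]) auto
  finally show ?thesis by (simp add: nn_integral_count_space_finite)
qed

sublocale joint: prob_space "joint D K"
proof
  have "emeasure (joint D K) (space (joint D K)) = (\<integral>\<^sup>+x. 1 \<partial>joint D K)"
    by simp
  also have "\<dots> = (\<integral>\<^sup>+s. 1 \<partial>D)"
    by (subst nn_integral_joint) (auto intro!: nn_integral_cong simp: pmf_bool_sum sum_ennreal simp del: nn_integral_const)
  also have "\<dots> = 1" using emeasure_space_1 by simp
  finally show "emeasure (joint D K) (space (joint D K)) = 1" .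
qed

lemma AE_joint_iff:
  assumes [measurable]: "Measurable.pred (borel \<Otimes>\<^sub>M count_space UNIV) \<phi>"
  shows "(AE x in joint D K. \<phi> x) \<longleftrightarrow> (AE s in D. \<forall>z. pmf (K s) z \<noteq> 0 \<longrightarrow> \<phi> (s, z))"
proof -
  have "(AE x in joint D K. \<phi> x) \<longleftrightarrow>
      (AE x in D \<Otimes>\<^sub>M count_space UNIV. pmf (K (fst x)) (snd x) \<noteq> 0 \<longrightarrow> \<phi> (fst x, snd x))"
    unfolding joint_eq by (subst AE_density) (auto simp: less_le)
  also have "\<dots> \<longleftrightarrow> (AE s in D. AE z in count_space UNIV. pmf (K s) z \<noteq> 0 \<longrightarrow> \<phi> (s, z))"
    by (rule pair.AE_pair_iff[symmetric]) measurable
  finally show ?thesis by (simp add: AE_count_space)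
qed

lemma integrable_joint_iff:
  fixes f :: "(real ^ 'd) \<times> bool \<Rightarrow> real"
  assumes [measurable]: "f \<in> borel_measurable (borel \<Otimes>\<^sub>M count_space UNIV)"
  shows "integrable (joint D K) f \<longleftrightarrow> (\<forall>z. integrable D (\<lambda>s. pmf (K s) z * f (s, z)))"
proof -
  have "(\<integral>\<^sup>+x. norm (f x) \<partial>joint D K) = (\<Sum>z\<in>UNIV. \<integral>\<^sup>+s. norm (pmf (K s) z * f (s, z)) \<partial>D)"
    by (subst nn_integral_joint, simp, subst nn_integral_sum[symmetric])
       (auto simp: abs_mult ennreal_mult)
  then show ?thesis
    by (simp add: integrable_iff_bounded UNIV_bool all_bool_eq less_top[symmetric] conj_commute)
qed

lemma integral_joint:
  fixes f :: "(real ^ 'd) \<times> bool \<Rightarrow> real"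
  assumes [measurable]: "f \<in> borel_measurable (borel \<Otimes>\<^sub>M count_space UNIV)"
    and int: "integrable (joint D K) f"
  shows "(\<integral>x. f x \<partial>joint D K) = (\<integral>s. (\<Sum>z\<in>UNIV. pmf (K s) z * f (s, z)) \<partial>D)"
proof -
  have "integrable (D \<Otimes>\<^sub>M count_space UNIV) (\<lambda>x. pmf (K (fst x)) (snd x) * f x)"
    using int unfolding joint_eq by (subst (asm) integrable_real_density) auto
  from pair.integral_fst'[OF this]
  have "(\<integral>x. pmf (K (fst x)) (snd x) * f x \<partial>(D \<Otimes>\<^sub>M count_space UNIV)) = (\<integral>s. (\<Sum>z\<in>UNIV. pmf (K s) z * f (s, z)) \<partial>D)"
    by (simp add: lebesgue_integral_count_space_finite)
  moreover have "(\<integral>x. f x \<partial>joint D K) = (\<integral>x. pmf (K (fst x)) (snd x) * f x \<partial>(D \<Otimes>\<^sub>M count_space UNIV))"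
    unfolding joint_eq by (subst integral_real_density) auto
  ultimately show ?thesis by simp
qed

lemma integrable_bounded:
  fixes f :: "real ^ 'd \<Rightarrow> real"
  assumes [measurable]: "f \<in> borel_measurable borel" and "\<And>s. \<bar>f s\<bar> \<le> B"
  shows "integrable D f"
  by (rule integrable_const_bound[of _ B]) (use assms(2) in auto)

section \<open>Label marginals, entropies and the information density\<close>

lemma label_marginal_eq: "label_marginal D K z = (\<integral>s. pmf (K s) z \<partial>D)"
proof -
  have "label_marginal D K z = (\<integral>x. indicator {x. snd x = z} x \<partial>joint D K)"
    unfolding label_marginal_def by simp
  also have "\<dots> = (\<integral>s. (\<Sum>z'\<in>UNIV. pmf (K s) z' * indicator {x. snd x = z} (s, z')) \<partial>D)"
    by (rule integral_joint) (auto intro!: joint.integrable_const_bound[of _ 1])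
  also have "\<dots> = (\<integral>s. pmf (K s) z \<partial>D)"
    by (intro Bochner_Integration.integral_cong refl) simp
  finally show ?thesis .
qed

lemma label_marginal_bounds: "0 \<le> label_marginal D K z" "label_marginal D K z \<le> 1"
  unfolding label_marginal_def by auto

text \<open>A vanishing marginal is a vanishing integral of a nonnegative function, so the label has
  probability 0 almost everywhere. This is the absolute continuity that splitting the logarithms and
  Gibbs' inequality require.\<close>

lemma AE_label_marginal: "AE s in D. \<forall>z. pmf (K s) z \<noteq> 0 \<longrightarrow> label_marginal D K z \<noteq> 0"
proof -
  have "AE s in D. pmf (K s) z \<noteq> 0 \<longrightarrow> label_marginal D K z \<noteq> 0" for z
  proof (cases "label_marginal D K z = 0")
    case True
    moreover have "integrable D (\<lambda>s. pmf (K s) z)"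
      by (rule integrable_bounded[of _ 1]) (auto simp: pmf_le_1)
    ultimately have "AE s in D. pmf (K s) z = 0"
      by (simp add: label_marginal_eq integral_nonneg_eq_0_iff_AE)
    then show ?thesis by eventually_elim simp
  qed simp
  then show ?thesis by (simp add: AE_all_countable)
qed

lemma prob_UNIV [simp]: "prob UNIV = 1"
  using prob_space by simp

definition label_entropy :: real where
  "label_entropy = - (\<Sum>z\<in>UNIV. label_marginal D K z * ln (label_marginal D K z))"

definition cond_entropy :: real where
  "cond_entropy = (\<integral>s. pmf_entropy (K s) \<partial>D)"

text \<open>Minus the information density: its mean under \<open>joint D K\<close> is minus the
  mutual information.\<close>

definition marginal_log_ratio :: "(real ^ 'd) \<times> bool \<Rightarrow> real" where
  "marginal_log_ratio = (\<lambda>(s, z). ln (label_marginal D K z / pmf (K s) z))"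

lemma measurable_marginal_log_ratio [measurable]:
  "marginal_log_ratio \<in> borel_measurable (borel \<Otimes>\<^sub>M count_space UNIV)"
  unfolding marginal_log_ratio_def by (rule measurable_pair_bool) simp

lemma sum_label_marginal: "(\<Sum>z\<in>UNIV. label_marginal D K z) = 1"
proof -
  have "(\<Sum>z\<in>UNIV. label_marginal D K z) = (\<integral>s. (\<Sum>z\<in>UNIV. pmf (K s) z) \<partial>D)"
    unfolding label_marginal_eq
    by (intro Bochner_Integration.integral_sum[symmetric] integrable_bounded[of _ 1]) (auto simp: pmf_le_1)
  then show ?thesis by (simp add: pmf_bool_sum)
qed

lemma integrable_square_marginal_log_ratio:
  "integrable (joint D K) (\<lambda>x. (marginal_log_ratio x)\<^sup>2)"
proof (subst integrable_joint_iff; (intro allI)?)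
  fix z
  let ?p = "label_marginal D K z"
  have "pmf (K s) z * (ln (?p / pmf (K s) z))\<^sup>2 \<le> 2 * (ln ?p)\<^sup>2 + 2" for s
  proof -
    \<comment> \<open>Only an inequality: if \<open>?p\<close> or \<open>pmf (K s) z\<close> is 0,
      the left side is 0 by the default values.\<close>
    have "(ln (?p / pmf (K s) z))\<^sup>2 \<le> (ln ?p - ln (pmf (K s) z))\<^sup>2" by (simp add: ln_div)
    also have "\<dots> \<le> 2 * (ln ?p)\<^sup>2 + 2 * (ln (pmf (K s) z))\<^sup>2"
      using zero_le_power2[of "ln ?p + ln (pmf (K s) z)"] unfolding power2_diff power2_sum by linarith
    finally have "pmf (K s) z * (ln (?p / pmf (K s) z))\<^sup>2 \<le> pmf (K s) z * (2 * (ln ?p)\<^sup>2 + 2 * (ln (pmf (K s) z))\<^sup>2)"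
      by (intro mult_left_mono) auto
    also have "\<dots> = pmf (K s) z * (2 * (ln ?p)\<^sup>2) + 2 * (pmf (K s) z * (ln (pmf (K s) z))\<^sup>2)"
      by (simp add: algebra_simps)
    also have "\<dots> \<le> 2 * (ln ?p)\<^sup>2 + 2"
      using mult_ln_squared_le[of "pmf (K s) z"] mult_right_mono[of "pmf (K s) z" 1 "2 * (ln ?p)\<^sup>2"]
      by (simp add: pmf_le_1)
    finally show ?thesis .
  qed
  then show "integrable D (\<lambda>s. pmf (K s) z * (marginal_log_ratio (s, z))\<^sup>2)"
    unfolding marginal_log_ratio_def by (intro integrable_bounded[of _ "2 * (ln ?p)\<^sup>2 + 2"]) auto
qed simp

lemma integrable_marginal_log_ratio: "integrable (joint D K) marginal_log_ratio"
  by (rule joint.square_integrable_imp_integrable[OF _ integrable_square_marginal_log_ratio]) simp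

lemma integrable_pmf_mult_ln: "integrable D (\<lambda>s. pmf (K s) z * ln (pmf (K s) z))"
  by (rule integrable_bounded[of _ 1]) (auto intro!: abs_mult_ln_le simp: pmf_le_1)

lemma integrable_pmf_entropy: "integrable D (\<lambda>s. pmf_entropy (K s))"
  unfolding pmf_entropy_def using integrable_pmf_mult_ln by simp

lemma integral_ln_pmf: "(\<integral>(s, z). ln (pmf (K s) z) \<partial>joint D K) = - cond_entropy"
proof -
  have [measurable]: "(\<lambda>(s, z). ln (pmf (K s) z)) \<in> borel_measurable (borel \<Otimes>\<^sub>M count_space UNIV)"
    by (rule measurable_pair_bool) simp
  have "integrable (joint D K) (\<lambda>(s, z). ln (pmf (K s) z))"
    by (subst integrable_joint_iff) (auto intro: integrable_pmf_mult_ln)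
  then show ?thesis
    by (subst integral_joint) (auto simp: cond_entropy_def pmf_entropy_def)
qed

lemma integral_marginal_log_ratio:
  "(\<integral>x. marginal_log_ratio x \<partial>joint D K) = cond_entropy - label_entropy"
proof -
  have "(\<integral>x. marginal_log_ratio x \<partial>joint D K)
      = (\<integral>s. (\<Sum>z\<in>UNIV. pmf (K s) z * ln (label_marginal D K z / pmf (K s) z)) \<partial>D)"
    by (subst integral_joint[OF _ integrable_marginal_log_ratio]) (auto simp: marginal_log_ratio_def)
  also have "\<dots> = (\<integral>s. (\<Sum>z\<in>UNIV. pmf (K s) z * ln (label_marginal D K z)) + pmf_entropy (K s) \<partial>D)"
  proof (rule integral_cong_AE)
    show "AE s in D. (\<Sum>z\<in>UNIV. pmf (K s) z * ln (label_marginal D K z / pmf (K s) z))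
        = (\<Sum>z\<in>UNIV. pmf (K s) z * ln (label_marginal D K z)) + pmf_entropy (K s)"
      using AE_label_marginal
    proof eventually_elim
      case (elim s)
      then have "pmf (K s) z * ln (label_marginal D K z / pmf (K s) z)
          = pmf (K s) z * ln (label_marginal D K z) - pmf (K s) z * ln (pmf (K s) z)" for z
        by (cases "pmf (K s) z = 0") (auto simp: ln_div algebra_simps)
      then show ?case by (simp add: pmf_entropy_def sum_subtractf)
    qed
  qed (simp_all add: pmf_entropy_def)
  also have "\<dots> = (\<Sum>z\<in>UNIV. label_marginal D K z * ln (label_marginal D K z)) + cond_entropy"
  proof -
    have int: "integrable D (\<lambda>s. pmf (K s) z)" for z
      by (rule integrable_bounded[of _ 1]) (auto simp: pmf_le_1)
    then show ?thesis
      using integrable_pmf_entropy by (simp add: label_marginal_eq cond_entropy_def)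
  qed
  finally show ?thesis by (simp add: label_entropy_def)
qed

section \<open>Mutual information as an integral, its positivity and independence\<close>

lemma distr_joint_fst: "distr (joint D K) D fst = D"
proof (rule measure_eqI)
  fix A assume "A \<in> sets (distr (joint D K) D fst)"
  then have A [measurable]: "A \<in> sets borel" by simp
  have "emeasure (distr (joint D K) D fst) A = (\<integral>\<^sup>+x. indicator A (fst x) \<partial>joint D K)"
    by (subst nn_integral_indicator[symmetric], simp, subst nn_integral_distr) auto
  also have "\<dots> = (\<integral>\<^sup>+s. indicator A s \<partial>D)"
    by (subst nn_integral_joint) (auto intro!: nn_integral_cong simp: pmf_bool_sum sum_ennreal simp flip: sum_distrib_right)
  finally show "emeasure (distr (joint D K) D fst) A = emeasure D A" by simp
qed simp

lemma distr_joint_snd: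
  "distr (joint D K) (count_space UNIV) snd = density (count_space UNIV) (\<lambda>z. ennreal (label_marginal D K z))"
proof (rule measure_eqI_countable[where A = UNIV])
  fix z :: bool
  have "emeasure (distr (joint D K) (count_space UNIV) snd) {z} = emeasure (joint D K) {x \<in> space (joint D K). snd x = z}"
    by (subst emeasure_distr) (auto intro!: arg_cong[where f = "emeasure (joint D K)"])
  also have "\<dots> = ennreal (label_marginal D K z)"
    unfolding label_marginal_def by (simp add: joint.emeasure_eq_measure)
  also have "\<dots> = emeasure (density (count_space UNIV) (\<lambda>z. ennreal (label_marginal D K z))) {z}"
    by (subst emeasure_density) (auto simp: nn_integral_count_space_finite UNIV_bool indicator_def)
  finally show "emeasure (distr (joint D K) (count_space UNIV) snd) {z} = \<dots>" .
qed auto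

text \<open>An arbitrary feature law may have no Lebesgue density, so \<open>D\<close> itself is the
  reference measure: features then have density 1, labels have their marginal as density on the
  counting measure, and pairs have the kernel.\<close>

lemma mutual_info_eq_integral: "mutual_info D K = - (\<integral>x. marginal_log_ratio x \<partial>joint D K)"
proof -
  interpret I: information_space "joint D K" "exp 1" by standard simp
  let ?C = "count_space (UNIV :: bool set)"
  \<comment> \<open>Replacing \<open>borel\<close> by \<open>D\<close> is harmless, as a target
    measure of \<open>distr\<close> matters only through its sigma-algebra.\<close>
  have "mutual_info D K = joint.mutual_information (exp 1) D ?C fst snd"
    unfolding mutual_info_def joint.mutual_information_def
    by (intro arg_cong2[where f = "KL_divergence (exp 1)"] arg_cong2[where f = pair_measure] distr_cong sets_pair_measure_cong)
       simp_all
  also have "\<dots> = (\<integral>x. pmf (K (fst x)) (snd x) * log (exp 1) (pmf (K (fst x)) (snd x) / (1 * label_marginal D K (snd x))) \<partial>(D \<Otimes>\<^sub>M ?C))"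
  proof (rule I.mutual_information_distr)
    show "distributed (joint D K) D fst (\<lambda>_. ennreal 1)"
      unfolding distributed_def using distr_joint_fst by (auto simp: density_1)
    show "distributed (joint D K) ?C snd (\<lambda>z. ennreal (label_marginal D K z))"
      unfolding distributed_def using distr_joint_snd by auto
    show "distributed (joint D K) (D \<Otimes>\<^sub>M ?C) (\<lambda>x. (fst x, snd x)) (\<lambda>x. ennreal (pmf (K (fst x)) (snd x)))"
      unfolding distributed_def joint_eq by (auto simp: distr_id2)
  qed (use label_marginal_bounds in \<open>auto intro: sigma_finite_measure_axioms sigma_finite_measure_count_space_finite\<close>)
  also have "\<dots> = (\<integral>x. pmf (K (fst x)) (snd x) * - marginal_log_ratio x \<partial>(D \<Otimes>\<^sub>M ?C))"
    by (intro Bochner_Integration.integral_cong refl)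
       (auto simp: marginal_log_ratio_def log_def ln_div algebra_simps split: prod.split)
  also have "\<dots> = (\<integral>x. - marginal_log_ratio x \<partial>joint D K)"
    unfolding joint_eq by (subst integral_real_density) auto
  finally show ?thesis by simp
qed

lemma mutual_info_eq: "mutual_info D K = label_entropy - cond_entropy"
  unfolding mutual_info_eq_integral integral_marginal_log_ratio by simp

text \<open>Gibbs' inequality at each feature, comparing \<open>K s\<close> with the label marginal.
  A zero integral of the nonnegative integrand forces the equality case almost everywhere.\<close>

lemma mutual_info_nonneg: "0 \<le> mutual_info D K"
  and mutual_info_0: "mutual_info D K = 0 \<Longrightarrow> AE s in D. \<forall>z. pmf (K s) z = label_marginal D K z"
proof -
  let ?g = "\<lambda>s. \<Sum>z\<in>UNIV. pmf (K s) z * ln (label_marginal D K z / pmf (K s) z)"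
  have int: "integrable D ?g"
    using integrable_marginal_log_ratio
    by (subst (asm) integrable_joint_iff) (auto simp: marginal_log_ratio_def)
  have eq: "mutual_info D K = (\<integral>s. - ?g s \<partial>D)"
    unfolding mutual_info_eq_integral
    by (subst integral_joint[OF _ integrable_marginal_log_ratio]) (auto simp: marginal_log_ratio_def)
  have le: "AE s in D. 0 \<le> - ?g s"
    using AE_label_marginal by eventually_elim (use gibbs_pmf(1) label_marginal_bounds sum_label_marginal in auto)
  show "0 \<le> mutual_info D K"
    unfolding eq by (intro integral_nonneg_AE le)
  assume "mutual_info D K = 0"
  then have "AE s in D. - ?g s = 0"
    unfolding eq using int by (subst (asm) integral_nonneg_eq_0_iff_AE) (use le in auto)
  then show "AE s in D. \<forall>z. pmf (K s) z = label_marginal D K z"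
    using AE_label_marginal
    by eventually_elim (use gibbs_pmf(2) label_marginal_bounds sum_label_marginal in auto)
qed

text \<open>By contraposition: zero information makes the kernel constant almost everywhere, and the
  joint law is then a product.\<close>

lemma alternative_H1_imp_mutual_info_pos:
  assumes "alternative_H1 D K"
  shows "0 < mutual_info D K"
proof (rule ccontr)
  assume "\<not> ?thesis"
  then have AE: "AE s in D. \<forall>z. pmf (K s) z = label_marginal D K z"
    using mutual_info_nonneg by (intro mutual_info_0) simp
  \<comment> \<open>Rectangles are enough, since the two set systems consist of all preimages.
    Taking \<open>UNIV\<close> on either side yields the two marginals.\<close>
  have prob: "joint.prob (fst -` B \<inter> snd -` C) = prob B * (\<Sum>z\<in>C. label_marginal D K z)"
    if [measurable]: "B \<in> sets borel" for B and C :: "bool set"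
  proof -
    have "joint.prob (fst -` B \<inter> snd -` C) = (\<integral>x. indicator B (fst x) * indicator C (snd x) \<partial>joint D K)"
      by (simp flip: indicator_vimage indicator_inter_arith)
    also have "\<dots> = (\<integral>s. (\<Sum>z\<in>UNIV. pmf (K s) z * (indicator B s * indicator C z)) \<partial>D)"
      by (subst integral_joint) (auto intro!: joint.integrable_const_bound[of _ 1] split: split_indicator)
    also have "\<dots> = (\<integral>s. indicator B s * (\<Sum>z\<in>C. label_marginal D K z) \<partial>D)"
    proof (rule integral_cong_AE)
      show "AE s in D. (\<Sum>z\<in>UNIV. pmf (K s) z * (indicator B s * indicator C z))
          = indicator B s * (\<Sum>z\<in>C. label_marginal D K z)"
        using AE
      proof eventually_elim
        case (elim s)
        then show ?case
          by (simp add: sum_distrib_left indicator_def sum.If_cases mult.commute if_distrib[of "\<lambda>x. _ * x"] cong: if_cong)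
      qed
    qed simp_all
    finally show ?thesis by simp
  qed
  have "joint.indep_set {fst -` B \<inter> space (joint D K) | B. B \<in> sets borel}
          {snd -` C \<inter> space (joint D K) | C. True}"
  proof (rule joint.indep_setI)
    fix a b
    assume "a \<in> {fst -` B \<inter> space (joint D K) | B. B \<in> sets borel}" "b \<in> {snd -` C \<inter> space (joint D K) | C. True}"
    then obtain B C where B: "B \<in> sets borel" and ab: "a = fst -` B" "b = snd -` C" by auto
    have "joint.prob a = prob B" 
      using prob[OF B, of UNIV] ab sum_label_marginal by simp
    moreover have "joint.prob b = (\<Sum>z\<in>C. label_marginal D K z)"
      using prob[of UNIV C] ab by simp
    ultimately show "joint.prob (a \<inter> b) = joint.prob a * joint.prob b"
      using prob[OF B, of C] ab by simp
  next
    have "fst -` B \<in> sets (borel \<Otimes>\<^sub>M count_space (UNIV :: bool set))" if "B \<in> sets borel" for B :: "(real ^ 'd) set"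
      using measurable_sets[OF measurable_fst[of borel "count_space UNIV"] that] by (simp add: space_pair_measure)
    then show "{fst -` B \<inter> space (joint D K) | B. B \<in> sets borel} \<subseteq> joint.events" by auto
    have "snd -` C \<in> sets ((borel :: (real ^ 'd) measure) \<Otimes>\<^sub>M count_space UNIV)" for C :: "bool set"
      using measurable_sets[OF measurable_snd[of borel "count_space UNIV"], of C] by (simp add: space_pair_measure)
    then show "{snd -` C \<inter> space (joint D K) | C. True} \<subseteq> joint.events" by auto
  qed
  then show False using assms by (simp add: alternative_H1_def)
qed

end

subsection \<open>Mean and variance of the log-ratio\<close>

text \<open>Square integrability is required under the first kernel only. The locale is used in both
  orders: with P first its \<open>sq_error\<close> is bounded by \<epsilon>1, with Q first by
  \<epsilon>2.\<close>

locale two_kernels = P: labelled D P + Q: labelled D Q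
  for D :: "(real ^ 'd) measure" and P Q :: "'d kernel" +
  assumes same_null: "AE s in D. \<forall>z. pmf (P s) z = 0 \<longleftrightarrow> pmf (Q s) z = 0"
    and square_integrable: "integrable (joint D P) (\<lambda>x. (log_ratio Q P x)\<^sup>2)"
begin

lemma measurable_log_ratio [measurable]:
  "log_ratio Q P \<in> borel_measurable (borel \<Otimes>\<^sub>M count_space UNIV)"
  unfolding log_ratio_def by (rule P.measurable_pair_bool) simp

lemma measurable_llr [measurable]: "llr D P Q \<in> borel_measurable (borel \<Otimes>\<^sub>M count_space UNIV)"
  unfolding llr_def by (rule P.measurable_pair_bool) simp

lemma integrable_log_ratio: "integrable (joint D P) (log_ratio Q P)"
  by (rule P.joint.square_integrable_imp_integrable[OF _ square_integrable]) simp

definition sq_error :: real where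
  "sq_error = (\<integral>x. (log_ratio Q P x)\<^sup>2 \<partial>joint D P)"

lemma sq_error_nonneg: "0 \<le> sq_error"
  by (simp add: sq_error_def)

lemma sq_error_eq: "sq_error = (\<integral>s. (\<Sum>z\<in>UNIV. pmf (P s) z * (ln (pmf (Q s) z / pmf (P s) z))\<^sup>2) \<partial>D)"
  unfolding sq_error_def by (subst P.integral_joint[OF _ square_integrable]) (auto simp: log_ratio_def)

lemma AE_joint_pos: "AE x in joint D P. pmf (P (fst x)) (snd x) \<noteq> 0 \<and> pmf (Q (fst x)) (snd x) \<noteq> 0
    \<and> label_marginal D P (snd x) \<noteq> 0"
proof (subst P.AE_joint_iff)
  show "AE s in D. \<forall>z. pmf (P s) z \<noteq> 0 \<longrightarrow> pmf (P (fst (s, z))) (snd (s, z)) \<noteq> 0 \<and>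
      pmf (Q (fst (s, z))) (snd (s, z)) \<noteq> 0 \<and> label_marginal D P (snd (s, z)) \<noteq> 0"
    using same_null P.AE_label_marginal by eventually_elim auto
qed measurable

text \<open>Separates what the labels reveal from the error of the predictor; the mean and variance
  bounds both come from this splitting.\<close>

lemma llr_AE_eq: "AE x in joint D P. llr D P Q x = P.marginal_log_ratio x - log_ratio Q P x"
  using AE_joint_pos
  by eventually_elim (auto simp: llr_def P.marginal_log_ratio_def log_ratio_def ln_div split: prod.splits)

lemma square_integrable_llr: "integrable (joint D P) (\<lambda>x. (llr D P Q x)\<^sup>2)"
proof -
  have "integrable (joint D P) (\<lambda>x. (P.marginal_log_ratio x + - log_ratio Q P x)\<^sup>2)"
    using P.integrable_square_marginal_log_ratio square_integrable
    by (intro integrable_sum_square) auto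
  then show ?thesis
    by (rule integrable_cong_AE_imp) (use llr_AE_eq in \<open>auto elim: eventually_mono\<close>)
qed

lemma integral_llr:
  "(\<integral>x. llr D P Q x \<partial>joint D P) = - mutual_info D P - (\<integral>x. log_ratio Q P x \<partial>joint D P)"
proof -
  have "(\<integral>x. llr D P Q x \<partial>joint D P) = (\<integral>x. P.marginal_log_ratio x - log_ratio Q P x \<partial>joint D P)"
    by (intro integral_cong_AE llr_AE_eq) auto
  then show ?thesis
    using P.integrable_marginal_log_ratio integrable_log_ratio by (simp add: P.mutual_info_eq_integral)
qed

lemma abs_integral_log_ratio_le: "\<bar>\<integral>x. log_ratio Q P x \<partial>joint D P\<bar> \<le> sqrt sq_error"
  unfolding sq_error_def by (rule P.joint.abs_expectation_le_sqrt[OF _ square_integrable]) simp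

text \<open>Minkowski for the splitting, with the variance of the predictor error replaced by its
  second moment. This is the origin of the denominator in the power bounds.\<close>

lemma var_llr_le:
  "var (joint D P) (llr D P Q) \<le> sq_error + info_var D P + 2 * sqrt (info_var D P) * sqrt sq_error"
proof -
  have prob: "prob_space (joint D P)" by unfold_locales
  have info: "var (joint D P) P.marginal_log_ratio = info_var D P"
    unfolding info_var_def var_def P.marginal_log_ratio_def
    by (simp add: case_prod_beta' power2_commute)
  have "var (joint D P) (llr D P Q) = var (joint D P) (\<lambda>x. P.marginal_log_ratio x - log_ratio Q P x)"
  proof -
    have eq: "(\<integral>x. llr D P Q x \<partial>joint D P) = (\<integral>x. P.marginal_log_ratio x - log_ratio Q P x \<partial>joint D P)"
      by (intro integral_cong_AE llr_AE_eq) auto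
    show ?thesis unfolding var_def eq
      by (rule integral_cong_AE) (use llr_AE_eq in \<open>auto elim: eventually_mono\<close>)
  qed
  also have "\<dots> \<le> info_var D P + var (joint D P) (log_ratio Q P)
      + 2 * sqrt (info_var D P) * sqrt (var (joint D P) (log_ratio Q P))"
    using var_diff_le[OF prob _ _ P.integrable_square_marginal_log_ratio square_integrable] by (simp add: info)
  also have "\<dots> \<le> info_var D P + sq_error + 2 * sqrt (info_var D P) * sqrt sq_error"
  proof -
    have "var (joint D P) (log_ratio Q P) \<le> sq_error"
      unfolding sq_error_def by (rule var_le_second_moment[OF prob _ square_integrable]) simp
    moreover have "0 \<le> info_var D P" unfolding info_var_def by (rule var_nonneg)
    ultimately show ?thesis by (intro add_mono mult_left_mono) auto
  qed
  finally show ?thesis by simp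
qed

text \<open>
  Equality in the Cauchy--Schwarz bound makes Q a constant multiple of P on the labels that P
  charges; by \<open>same_null\<close> both are normalised on the same labels, so the constant is 1.
\<close>

lemma extremal_imp_kernels_eq:
  assumes "- (\<integral>x. log_ratio Q P x \<partial>joint D P) = sqrt e" "sq_error \<le> e"
  shows "AE s in D. \<forall>z. pmf (Q s) z = pmf (P s) z" and "e = 0"
proof -
  let ?W = "log_ratio Q P"
  have e: "0 \<le> e" using assms(2) sq_error_nonneg by simp
  \<comment> \<open>The squared mean is \<open>e\<close> and the second moment at most
    \<open>e\<close>, so no variance is left and \<open>?W\<close> is constant almost
    surely.\<close>
  have "P.joint.variance ?W = sq_error - (\<integral>x. ?W x \<partial>joint D P)\<^sup>2"
    unfolding sq_error_def using integrable_log_ratio square_integrable by (rule P.joint.variance_eq)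
  also have "(\<integral>x. ?W x \<partial>joint D P)\<^sup>2 = (- sqrt e)\<^sup>2"
    using assms(1) by (simp add: minus_equation_iff[of _ "sqrt e"])
  finally have "P.joint.variance ?W \<le> 0" using assms(2) e by simp
  then have "P.joint.variance ?W = 0"
    using P.joint.variance_positive[of ?W] by linarith
  moreover have "integrable (joint D P) (\<lambda>x. (?W x - P.joint.expectation ?W)\<^sup>2)"
    using integrable_log_ratio square_integrable by (simp add: power2_diff)
  ultimately have "AE x in joint D P. ?W x = P.joint.expectation ?W"
    using integral_nonneg_eq_0_iff_AE[of "joint D P" "\<lambda>x. (?W x - P.joint.expectation ?W)\<^sup>2"] by auto
  then have W: "AE x in joint D P. ?W x = - sqrt e"
    using assms(1) by (simp add: minus_equation_iff[of _ "sqrt e"])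
  then have "AE s in D. \<forall>z. pmf (P s) z \<noteq> 0 \<longrightarrow> ?W (s, z) = - sqrt e"
    by (subst (asm) P.AE_joint_iff) auto
  then have AE: "AE s in D. sqrt e = 0 \<and> (\<forall>z. pmf (Q s) z = pmf (P s) z)"
    using same_null
  proof eventually_elim
    case (elim s)
    have Q: "pmf (Q s) z = exp (- sqrt e) * pmf (P s) z" for z
    proof (cases "pmf (P s) z = 0")
      case False
      then have pos: "0 < pmf (P s) z" "0 < pmf (Q s) z" using elim by (auto simp: less_le)
      then have "ln (pmf (Q s) z / pmf (P s) z) = - sqrt e"
        using elim False by (simp add: log_ratio_def)
      then have "pmf (Q s) z / pmf (P s) z = exp (- sqrt e)"
        using pos by (metis divide_pos_pos exp_ln)
      then show ?thesis using pos by (simp add: field_simps)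
    qed (use elim in auto)
    have "exp (- sqrt e) = exp (- sqrt e) * (\<Sum>z\<in>UNIV. pmf (P s) z)" by (simp add: pmf_bool_sum)
    also have "\<dots> = (\<Sum>z\<in>UNIV. pmf (Q s) z)" unfolding Q sum_distrib_left ..
    finally have "exp (- sqrt e) = 1" by (simp add: pmf_bool_sum)
    then show ?case using Q by simp
  qed
  then show "AE s in D. \<forall>z. pmf (Q s) z = pmf (P s) z" by eventually_elim simp
  from AE have "AE s in D. sqrt e = 0" by eventually_elim simp
  then show "e = 0" by (simp add: P.AE_const)
qed

lemma sq_error_0_imp_kernels_eq:
  assumes "sq_error = 0"
  shows "AE s in D. \<forall>z. pmf (Q s) z = pmf (P s) z"
  using extremal_imp_kernels_eq(1)[of 0] abs_integral_log_ratio_le assms by simp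

text \<open>The two-label entropy bound holds feature by feature; after integration, Jensen's
  inequality moves the square root outside.\<close>

lemma cond_entropy_diff_le: "P.cond_entropy - Q.cond_entropy \<le> sqrt sq_error"
proof -
  let ?e = "\<lambda>s. \<Sum>z\<in>UNIV. pmf (P s) z * (ln (pmf (Q s) z / pmf (P s) z))\<^sup>2"
  have nn: "0 \<le> ?e s" for s by (intro sum_nonneg) auto
  have int: "integrable D ?e"
    using square_integrable by (subst (asm) P.integrable_joint_iff) (auto simp: log_ratio_def)
  have int_sqrt: "integrable D (\<lambda>s. sqrt (?e s))"
  proof (rule P.square_integrable_imp_integrable)
    show "integrable D (\<lambda>s. (sqrt (?e s))\<^sup>2)" using int nn by simp
  qed simp
  have "P.cond_entropy - Q.cond_entropy = (\<integral>s. pmf_entropy (P s) - pmf_entropy (Q s) \<partial>D)"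
    unfolding P.cond_entropy_def Q.cond_entropy_def
    using P.integrable_pmf_entropy Q.integrable_pmf_entropy by simp
  also have "\<dots> \<le> (\<integral>s. sqrt (?e s) \<partial>D)"
  proof (rule integral_mono_AE)
    show "AE s in D. pmf_entropy (P s) - pmf_entropy (Q s) \<le> sqrt (?e s)"
      using same_null by eventually_elim (auto intro!: pmf_entropy_diff_le)
  qed (use P.integrable_pmf_entropy Q.integrable_pmf_entropy int_sqrt in auto)
  also have "\<dots> \<le> sqrt (\<integral>s. (sqrt (?e s))\<^sup>2 \<partial>D)"
    using P.abs_expectation_le_sqrt[of "\<lambda>s. sqrt (?e s)"] int nn by simp
  finally show ?thesis using nn by (simp add: sq_error_eq)
qed

section \<open>Power of the sequential test under normal approximation\<close>

text \<open>Only rejection at the last label is counted. There the product is at most \<alpha>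
  exactly when the sum of log-ratios is at most \<open>ln \<alpha>\<close>, because almost surely
  every factor is positive.\<close>

lemma test_power_ge:
  assumes "0 < \<alpha>" "1 \<le> n"
  shows "cdf (normal_law (\<integral>y. llr D P Q y \<partial>joint D P) (sqrt (var (joint D P) (llr D P Q) / real n))) (ln \<alpha> / real n)
      - clt_error D P Q n \<le> test_power D P Q n \<alpha>"
proof -
  have prob: "prob_space (joint D P)" by unfold_locales
  let ?\<Omega> = "sample_space D P"
  interpret \<Omega>: prob_space ?\<Omega>
    unfolding sample_space_def by (rule prob_space_PiM) (rule prob)
  have coord [measurable]: "(\<lambda>\<omega>. \<omega> i) \<in> measurable ?\<Omega> (borel \<Otimes>\<^sub>M count_space UNIV)" for i
    unfolding sample_space_def by simp
  have factor [measurable]: "(\<lambda>x. label_marginal D P (snd x) / pmf (Q (fst x)) (snd x))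
      \<in> borel_measurable ((borel :: (real ^ 'd) measure) \<Otimes>\<^sub>M count_space UNIV)"
    by measurable
  have stat [measurable]: "(\<lambda>\<omega>. statistic D P Q \<omega> m) \<in> borel_measurable ?\<Omega>" for m
    unfolding statistic_def by (intro borel_measurable_prod measurable_compose[OF coord factor])
  have "AE \<omega> in ?\<Omega>. pmf (P (fst (\<omega> i))) (snd (\<omega> i)) \<noteq> 0 \<and> pmf (Q (fst (\<omega> i))) (snd (\<omega> i)) \<noteq> 0
    \<and> label_marginal D P (snd (\<omega> i)) \<noteq> 0" for i
    unfolding sample_space_def
    by (rule AE_PiM_component[of UNIV "\<lambda>_. joint D P" i, OF prob UNIV_I AE_joint_pos])
  then have AE: "AE \<omega> in ?\<Omega>. \<forall>i. pmf (Q (fst (\<omega> i))) (snd (\<omega> i)) \<noteq> 0 \<and> label_marginal D P (snd (\<omega> i)) \<noteq> 0"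
    unfolding AE_all_countable by (auto elim: eventually_mono)
  have "cdf (normal_law (\<integral>y. llr D P Q y \<partial>joint D P) (sqrt (var (joint D P) (llr D P Q) / real n))) (ln \<alpha> / real n)
      - clt_error D P Q n \<le> \<Omega>.prob {\<omega> \<in> space ?\<Omega>. (\<Sum>i<n. llr D P Q (\<omega> i)) / real n \<le> ln \<alpha> / real n}"
    unfolding clt_error_def sample_space_def by (rule clt_deviation_le[OF prob])
  also have "\<dots> \<le> test_power D P Q n \<alpha>"
    unfolding test_power_def
  proof (rule \<Omega>.finite_measure_mono_AE)
    show "AE \<omega> in ?\<Omega>. \<omega> \<in> {\<omega> \<in> space ?\<Omega>. (\<Sum>i<n. llr D P Q (\<omega> i)) / real n \<le> ln \<alpha> / real n} \<longrightarrow>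
        \<omega> \<in> {\<omega> \<in> space ?\<Omega>. \<exists>m\<in>{1..n}. statistic D P Q \<omega> m \<le> \<alpha>}"
      using AE
    proof eventually_elim
      case (elim \<omega>)
      have pos: "0 < label_marginal D P (snd (\<omega> i)) / pmf (Q (fst (\<omega> i))) (snd (\<omega> i))" for i
        using elim P.label_marginal_bounds by (auto simp: less_le)
      have "ln (statistic D P Q \<omega> n) = (\<Sum>i<n. llr D P Q (\<omega> i))"
        unfolding statistic_def by (subst ln_prod) (use pos in \<open>auto simp: llr_def less_le case_prod_beta'\<close>)
      moreover have "0 < statistic D P Q \<omega> n"
        unfolding statistic_def using pos by (intro prod_pos) auto
      ultimately show ?case
        using assms ln_le_cancel_iff[of "statistic D P Q \<omega> n" \<alpha>]
        by (auto simp: divide_le_cancel intro!: bexI[of _ n])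
    qed
  qed measurable
  finally show ?thesis .
qed

text \<open>\<open>N n\<close> is the normal value with the true mean \<mu> and variance
  \<open>v\<close>; it remains to compare it with the claim, which uses \<open>c\<close> and
  \<open>V\<close>. Condition \<open>nondegenerate\<close> excludes a point mass at 0 with
  \<open>c = 0\<close>: then \<open>N n\<close> would be 0 while the claim tends to
  \<open>Phi 0\<close>.\<close>

lemma power_approx:
  assumes c: "c \<le> - (\<integral>y. llr D P Q y \<partial>joint D P)"
    and V: "0 < V" "var (joint D P) (llr D P Q) \<le> V"
    and nondegenerate: "c = 0 \<Longrightarrow> (\<integral>y. llr D P Q y \<partial>joint D P) = 0 \<Longrightarrow> var (joint D P) (llr D P Q) \<noteq> 0"
  shows "power_approx_at_least D P Q (\<lambda>Nq \<alpha>. (ln \<alpha> / sqrt (real Nq) + sqrt (real Nq) * c) / sqrt V)"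
  unfolding power_approx_at_least_def
proof (intro conjI allI impI)
  have prob: "prob_space (joint D P)" by unfold_locales
  show clt: "clt_error D P Q \<longlonglongrightarrow> 0"
    unfolding clt_error_def[abs_def] sample_space_def
    by (rule clt_uniform[OF prob _ square_integrable_llr]) simp
  fix \<alpha> :: real assume \<alpha>: "0 < \<alpha>" "\<alpha> < 1"
  define \<mu> where "\<mu> = (\<integral>y. llr D P Q y \<partial>joint D P)"
  define v where "v = var (joint D P) (llr D P Q)"
  have v0: "0 \<le> v" by (simp add: v_def var_nonneg)
  have vV: "v \<le> V" using V by (simp add: v_def)
  have c\<mu>: "c \<le> - \<mu>" using c by (simp add: \<mu>_def)
  have ln: "ln \<alpha> < 0" using \<alpha> by simp
  let ?b = "\<lambda>n. (ln \<alpha> / sqrt (real n) + sqrt (real n) * c) / sqrt V"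
  \<comment> \<open>The distance of the threshold from the mean, scaled by
    \<open>sqrt (real n)\<close> but not yet by the standard deviation.\<close>
  define s where "s n = ln \<alpha> / sqrt (real n) - sqrt (real n) * \<mu>" for n
  define N where "N n = cdf (normal_law \<mu> (sqrt (v / real n))) (ln \<alpha> / real n)" for n
  have s_eq: "s n = sqrt (real n) * (ln \<alpha> / real n - \<mu>)" if "1 \<le> n" for n
    using that by (simp add: s_def field_simps)
  have N_0: "N n = (if 0 \<le> s n then 1 else 0)" if "1 \<le> n" "v = 0" for n
    using that s_eq[OF that(1)] by (simp add: N_def cdf_normal_law_0 zero_le_mult_iff)
  have N_pos: "N n = Phi (s n / sqrt v)" if "1 \<le> n" "v \<noteq> 0" for n
  proof -
    have "(ln \<alpha> / real n - \<mu>) / sqrt (v / real n) = s n / sqrt v"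
      using that v0 by (simp add: s_eq real_sqrt_divide)
    then show ?thesis using that v0 by (simp add: N_def cdf_normal_law)
  qed
  have le_s: "ln \<alpha> / sqrt (real n) + sqrt (real n) * c \<le> s n" for n
    using mult_left_mono[OF c\<mu>, of "sqrt (real n)"] by (simp add: s_def)
  have Phi_le_N: "Phi (?b n) \<le> N n" if "1 \<le> n" "0 \<le> ?b n" for n
  proof -
    have num: "0 \<le> ln \<alpha> / sqrt (real n) + sqrt (real n) * c"
      using that(2) V(1) by (simp add: zero_le_divide_iff)
    show ?thesis
    proof (cases "v = 0")
      case True
      have "0 \<le> s n" using num le_s[of n] by linarith
      with True show ?thesis by (simp add: N_0[OF that(1)] Phi_le_1)
    next
      \<comment> \<open>A nonnegative numerator only grows when divided by the smaller
        \<open>sqrt v\<close>; this is where the sign of the argument matters.\<close>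
      case False
      then have "?b n \<le> (ln \<alpha> / sqrt (real n) + sqrt (real n) * c) / sqrt v"
        using num v0 vV by (intro divide_left_mono mult_pos_pos) auto
      also have "\<dots> \<le> s n / sqrt v"
        using le_s v0 by (intro divide_right_mono) auto
      finally show ?thesis unfolding N_pos[OF that(1) False] by (rule Phi_mono)
    qed
  qed
  \<comment> \<open>The excess of the claim over the normal value. It is set to 0 where the argument
    is nonnegative, so that the total error there stays within \<open>clt_error\<close>.\<close>
  define r where "r n = (if 0 \<le> ?b n then 0 else max 0 (Phi (?b n) - N n))" for n
  have r_nonneg: "0 \<le> r n" for n by (simp add: r_def)
  have N_nonneg: "0 \<le> N n" for n by (simp add: N_def cdf_def)
  have sqrt_top: "filterlim (\<lambda>n. sqrt (real n)) at_top sequentially"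
    by (rule filterlim_compose[OF sqrt_at_top filterlim_real_sequentially])
  have squeeze: "r \<longlonglongrightarrow> 0" if "g \<longlonglongrightarrow> 0" "\<forall>\<^sub>F n in sequentially. r n \<le> g n" for g
    by (rule tendsto_sandwich[OF _ that(2) tendsto_const that(1)]) (simp add: r_nonneg)
  have r: "r \<longlonglongrightarrow> 0"
  proof (cases c "0 :: real" rule: linorder_cases)
    case greater
    have "\<forall>\<^sub>F n in sequentially. r n = 0"
      using eventually_ge_at_top[of "nat \<lceil>- ln \<alpha> / c\<rceil>"] eventually_ge_at_top[of 1]
    proof eventually_elim
      case (elim n)
      then have "- ln \<alpha> / c \<le> real n" by linarith
      then have "0 \<le> ln \<alpha> + real n * c" using greater by (simp add: field_simps)
      then have "0 \<le> (ln \<alpha> + real n * c) / sqrt (real n)" by simp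
      also have "\<dots> = ln \<alpha> / sqrt (real n) + sqrt (real n) * c"
        using elim by (simp add: field_simps)
      finally show ?case using V by (simp add: r_def)
    qed
    then show ?thesis by (rule tendsto_eventually)
  next
    case less
    have "filterlim (\<lambda>n. c / sqrt V * sqrt (real n)) at_bot sequentially"
      by (rule filterlim_tendsto_neg_mult_at_bot[OF tendsto_const _ sqrt_top])
         (use less V in \<open>simp add: divide_neg_pos\<close>)
    then have "(\<lambda>n. Phi (c / sqrt V * sqrt (real n))) \<longlonglongrightarrow> 0"
      by (rule filterlim_compose[OF Phi_at_bot])
    moreover have "r n \<le> Phi (c / sqrt V * sqrt (real n))" for n
    proof -
      have "?b n \<le> (sqrt (real n) * c) / sqrt V"
        using ln V by (intro divide_right_mono) (auto simp: divide_nonpos_nonneg)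
      then have "Phi (?b n) \<le> Phi (c / sqrt V * sqrt (real n))" by (intro Phi_mono) (simp add: mult.commute)
      then show ?thesis using N_nonneg[of n] Phi_nonneg by (auto simp: r_def)
    qed
    ultimately show ?thesis by (intro squeeze always_eventually allI)
  next
    case equal
    have to0: "(\<lambda>n. ln \<alpha> / sqrt (real n) / k) \<longlonglongrightarrow> 0" for k
      using tendsto_divide_0[OF tendsto_const filterlim_at_top_imp_at_infinity[OF sqrt_top]]
      by (rule tendsto_divide_zero)
    show ?thesis
    proof (cases "v = 0")
      case True
      \<comment> \<open>The mean is then strictly below 0, so the thresholds, which tend to 0,
        eventually lie above the point mass at \<mu>, and \<open>N n\<close> becomes 1.\<close>
      then have \<mu>: "\<mu> < 0" using nondegenerate equal c\<mu> by (auto simp: v_def \<mu>_def less_le)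
      have "\<forall>\<^sub>F n in sequentially. r n = 0"
        using eventually_ge_at_top[of "nat \<lceil>ln \<alpha> / \<mu>\<rceil>"] eventually_ge_at_top[of 1]
      proof eventually_elim
        case (elim n)
        then have "ln \<alpha> / \<mu> \<le> real n" by linarith
        then have "0 \<le> s n" using \<mu> elim by (simp add: s_eq field_simps)
        then show ?case using True elim Phi_le_1[of "?b n"] by (simp add: r_def N_0)
      qed
      then show ?thesis by (rule tendsto_eventually)
    next
      case False
      \<comment> \<open>With \<open>c = 0\<close> both arguments tend to 0, so continuity of
        \<open>Phi\<close> closes the gap even though \<open>V\<close> may exceed
        \<open>v\<close>.\<close>
      let ?d = "\<lambda>n. \<bar>Phi (ln \<alpha> / sqrt (real n) / sqrt V) - Phi (ln \<alpha> / sqrt (real n) / sqrt v)\<bar>"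
      have Phi0: "(\<lambda>n. Phi (ln \<alpha> / sqrt (real n) / k)) \<longlonglongrightarrow> Phi 0" for k
        by (rule isCont_tendsto_compose[OF isCont_Phi to0])
      have "?d \<longlonglongrightarrow> 0"
        using tendsto_rabs[OF tendsto_diff[OF Phi0 Phi0]] by simp
      moreover have "\<forall>\<^sub>F n in sequentially. r n \<le> ?d n"
        using eventually_ge_at_top[of 1]
      proof eventually_elim
        case (elim n)
        have "ln \<alpha> / sqrt (real n) / sqrt v \<le> s n / sqrt v"
          using le_s[of n] equal v0 by (intro divide_right_mono) auto
        then have "Phi (ln \<alpha> / sqrt (real n) / sqrt v) \<le> N n"
          unfolding N_pos[OF elim False] by (rule Phi_mono)
        then show ?case using equal by (auto simp: r_def)
      qed
      ultimately show ?thesis by (rule squeeze)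
    qed
  qed
  have "(\<lambda>n. clt_error D P Q n + r n) \<longlonglongrightarrow> 0"
    using tendsto_add[OF clt r] by simp
  moreover have "Phi (?b n) - (clt_error D P Q n + r n) \<le> test_power D P Q n \<alpha>" if "1 \<le> n" for n
  proof -
    have "Phi (?b n) - r n \<le> N n" using Phi_le_N[OF that] by (auto simp: r_def)
    moreover have "N n - clt_error D P Q n \<le> test_power D P Q n \<alpha>"
      using test_power_ge[OF \<alpha>(1) that] by (simp add: N_def \<mu>_def v_def)
    ultimately show ?thesis by linarith
  qed
  ultimately show "\<exists>\<delta>. \<delta> \<longlonglongrightarrow> 0 \<and> (\<forall>n\<ge>1. Phi (?b n) - \<delta> n \<le> test_power D P Q n \<alpha> \<and>
      (0 \<le> ?b n \<longrightarrow> \<delta> n \<le> clt_error D P Q n))"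
    by (intro exI[of _ "\<lambda>n. clt_error D P Q n + r n"]) (auto simp: r_def)
qed

end

subsection \<open>Conditioning on the cells of a partition\<close>

text \<open>The complement of the support is a union of open null sets, and by Lindelof countably
  many of them cover it.\<close>

lemma AE_topological_support:
  fixes D :: "(real ^ 'd) measure"
  assumes "finite_measure D" "sets D = sets borel"
  shows "AE s in D. s \<in> topological_support D"
proof -
  interpret finite_measure D by fact
  let ?F = "{U. open U \<and> measure D U = 0}"
  obtain F where F: "F \<subseteq> ?F" "countable F" "\<Union>F = \<Union>?F"
    using Lindelof[of ?F] by auto
  have "AE s in D. \<forall>U\<in>F. s \<notin> U"
  proof (subst AE_ball_countable[OF F(2)], intro ballI)
    fix U assume "U \<in> F"
    then have "U \<in> null_sets D"
      using F(1) assms(2) by (auto simp: null_sets_def emeasure_eq_measure)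
    then show "AE s in D. s \<notin> U" by (rule AE_not_in)
  qed
  then show ?thesis
  proof eventually_elim
    case (elim s)
    then have "s \<notin> \<Union>?F" using F(3) by blast
    then show ?case unfolding topological_support_def
      by (auto simp: less_le)
  qed
qed

lemma finite_separated:
  fixes f :: "'a \<Rightarrow> real"
  assumes "finite S"
  obtains \<eta> where "0 < \<eta>" "\<And>x y. x \<in> S \<Longrightarrow> y \<in> S \<Longrightarrow> f x < f y \<Longrightarrow> f x + 2 * \<eta> < f y"
proof -
  \<comment> \<open>The positive gaps between values; the extra 1 keeps the set nonempty when
    \<open>f\<close> is constant on \<open>S\<close>.\<close>
  define G where "G = insert 1 ((\<lambda>(x, y). f y - f x) ` {(x, y) \<in> S \<times> S. f x < f y})"
  have "finite {(x, y) \<in> S \<times> S. f x < f y}"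
    by (rule finite_subset[of _ "S \<times> S"]) (use assms in auto)
  then have fin: "finite G" by (simp add: G_def)
  have "0 < Min G" using fin by (subst Min_gr_iff) (auto simp: G_def)
  show ?thesis
  proof
    \<comment> \<open>A third of the smallest gap, instead of a half, keeps the separation
      strict.\<close>
    show "0 < Min G / 3" using \<open>0 < Min G\<close> by simp
    fix x y assume "x \<in> S" "y \<in> S" "f x < f y"
    then have "Min G \<le> f y - f x" by (intro Min_le fin) (auto simp: G_def)
    then show "f x + 2 * (Min G / 3) < f y" using \<open>0 < Min G\<close> by linarith
  qed
qed

locale partitioned_model =
  fixes D :: "(real ^ 'd) measure" and P Q :: "'d kernel" and \<P> :: "(real ^ 'd) set set"
  assumes D: "prob_space D" "sets D = sets borel"
    and P_measurable: "\<And>z. (\<lambda>s. pmf (P s) z) \<in> borel_measurable borel"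
    and Q_measurable: "\<And>z. (\<lambda>s. pmf (Q s) z) \<in> borel_measurable borel"
    and partition: "partition_on (topological_support D) \<P>" "finite \<P>"
    and cells: "\<And>A. A \<in> \<P> \<Longrightarrow> A \<in> sets borel" "\<And>A. A \<in> \<P> \<Longrightarrow> measure D A > 0"
    and same_null_labels: "AE s in D. \<forall>z. pmf (P s) z = 0 \<longleftrightarrow> pmf (Q s) z = 0"
    and eps1_finite: "\<And>A. A \<in> \<P> \<Longrightarrow>
          integrable (joint (uniform_measure D A) P) (\<lambda>x. (log_ratio Q P x)\<^sup>2)"
    and eps2_finite: "\<And>A. A \<in> \<P> \<Longrightarrow>
          integrable (joint (uniform_measure D A) Q) (\<lambda>x. (log_ratio P Q x)\<^sup>2)"
begin

sublocale prob_space D by (rule D)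

sublocale whole_P: labelled D P
  by unfold_locales (use D P_measurable in auto)

sublocale whole_Q: labelled D Q
  by unfold_locales (use D Q_measurable in auto)

lemma emeasure_cell:
  assumes "A \<in> \<P>"
  shows "emeasure D A \<noteq> 0" "emeasure D A < \<infinity>"
  using cells(2)[OF assms] by (auto simp: emeasure_eq_measure)

lemma labelled_cell:
  assumes A: "A \<in> \<P>"
  shows "labelled (uniform_measure D A) P" "labelled (uniform_measure D A) Q"
proof -
  have "prob_space (uniform_measure D A)"
    using emeasure_cell[OF A] by (intro prob_space_uniform_measure) auto
  then show "labelled (uniform_measure D A) P" "labelled (uniform_measure D A) Q"
    using P_measurable Q_measurable D(2) by (auto simp: labelled_def labelled_axioms_def)
qed

lemma AE_cellI:
  assumes A: "A \<in> \<P>" and "AE s in D. \<phi> s"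
  shows "AE s in uniform_measure D A. \<phi> s"
  using assms(2) cells(1)[OF A] by (intro AE_uniform_measureI) (auto simp: D)

lemma two_kernels_cell: "A \<in> \<P> \<Longrightarrow> two_kernels (uniform_measure D A) P Q"
  using labelled_cell eps1_finite AE_cellI[OF _ same_null_labels]
  by (auto simp: two_kernels_def two_kernels_axioms_def)

lemma two_kernels_cell_swap:
  assumes A: "A \<in> \<P>"
  shows "two_kernels (uniform_measure D A) Q P"
proof -
  have "AE s in D. \<forall>z. pmf (Q s) z = 0 \<longleftrightarrow> pmf (P s) z = 0"
    using same_null_labels by eventually_elim auto
  then show ?thesis
    using labelled_cell[OF A] eps2_finite[OF A] AE_cellI[OF A]
    by (auto simp: two_kernels_def two_kernels_axioms_def)
qed

lemma AE_cells: "AE s in D. \<exists>A\<in>\<P>. s \<in> A"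
  using AE_topological_support[OF finite_measure_axioms D(2)]
  unfolding partition_onD1[OF partition(1)] by simp

lemma cells_nonempty: "\<P> \<noteq> {}"
proof
  assume "\<P> = {}"
  then have "AE s in D. False" using AE_cells by simp
  then show False by (simp add: AE_const)
qed

text \<open>Total expectation: the average over \<open>D\<close> is the mixture of the cell
  averages, weighted by cell probabilities of total at most 1. Nonnegative integrals let finiteness
  be a conclusion.\<close>

lemma nn_integral_le_cells:
  assumes [measurable]: "f \<in> borel_measurable borel"
    and le: "\<And>A. A \<in> \<P> \<Longrightarrow> (\<integral>\<^sup>+s. f s \<partial>uniform_measure D A) \<le> e"
  shows "(\<integral>\<^sup>+s. f s \<partial>D) \<le> e"
proof -
  note [measurable] = cells(1)
  have "(\<integral>\<^sup>+s. f s \<partial>D) \<le> (\<integral>\<^sup>+s. (\<Sum>A\<in>\<P>. f s * indicator A s) \<partial>D)"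
  proof (rule nn_integral_mono_AE)
    show "AE s in D. f s \<le> (\<Sum>A\<in>\<P>. f s * indicator A s)"
      using AE_cells
    proof eventually_elim
      case (elim s)
      then obtain A where A: "A \<in> \<P>" "s \<in> A" by auto
      then have "f s = (\<Sum>B\<in>{A}. f s * indicator B s)" by simp
      also have "\<dots> \<le> (\<Sum>A\<in>\<P>. f s * indicator A s)"
        using A partition(2) by (intro sum_mono2) auto
      finally show ?case .
    qed
  qed
  also have "\<dots> = (\<Sum>A\<in>\<P>. \<integral>\<^sup>+s. f s * indicator A s \<partial>D)"
    by (rule nn_integral_sum) auto
  also have "\<dots> \<le> (\<Sum>A\<in>\<P>. e * emeasure D A)"
  proof (rule sum_mono)
    fix A assume A: "A \<in> \<P>"
    have "(\<integral>\<^sup>+s. f s * indicator A s \<partial>D) = (\<integral>\<^sup>+s. f s * indicator A s \<partial>D) / emeasure D A * emeasure D A"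
      using emeasure_cell[OF A] by (simp add: ennreal_divide_times ennreal_mult_divide_eq divide_mult_eq)
    also have "\<dots> = (\<integral>\<^sup>+s. f s \<partial>uniform_measure D A) * emeasure D A"
      using A by (subst nn_integral_uniform_measure) auto
    also have "\<dots> \<le> e * emeasure D A"
      by (intro mult_right_mono le A) simp
    finally show "(\<integral>\<^sup>+s. f s * indicator A s \<partial>D) \<le> e * emeasure D A" .
  qed
  also have "\<dots> = e * (\<Sum>A\<in>\<P>. emeasure D A)"
    by (simp add: sum_distrib_left)
  also have "(\<Sum>A\<in>\<P>. emeasure D A) = emeasure D (\<Union>A\<in>\<P>. A)"
  proof (rule sum_emeasure)
    show "(\<lambda>A. A) ` \<P> \<subseteq> events" using cells(1) D(2) by auto
    show "disjoint_family_on (\<lambda>A. A) \<P>"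
      using partition_onD2[OF partition(1)] by (auto simp: disjoint_family_on_def disjoint_def)
  qed (rule partition(2))
  also have "e * \<dots> \<le> e * 1"
    by (intro mult_left_mono measure_le_1 emeasure_le_1) simp_all
  finally show ?thesis by simp
qed

lemma eps1_ge: "A \<in> \<P> \<Longrightarrow> two_kernels.sq_error (uniform_measure D A) P Q \<le> eps1 D P Q \<P>"
  unfolding eps1_def using partition(2) two_kernels.sq_error_def[OF two_kernels_cell] by (auto intro!: Max_ge)

lemma eps2_ge: "A \<in> \<P> \<Longrightarrow> two_kernels.sq_error (uniform_measure D A) Q P \<le> eps2 D P Q \<P>"
  unfolding eps2_def using partition(2) two_kernels.sq_error_def[OF two_kernels_cell_swap] by (auto intro!: Max_ge)

lemma eps1_nonneg: "0 \<le> eps1 D P Q \<P>"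
  using cells_nonempty eps1_ge two_kernels.sq_error_nonneg[OF two_kernels_cell] by (meson ex_in_conv order_trans)

text \<open>\<epsilon>1 is a maximum over cells, whereas the baseline test samples from the whole
  law. The mixture bound transfers both the integrability and the value.\<close>

lemma two_kernels_whole: "two_kernels D P Q" and sq_error_whole_le: "two_kernels.sq_error D P Q \<le> eps1 D P Q \<P>"
proof -
  let ?f = "\<lambda>x. (log_ratio Q P x)\<^sup>2"
  let ?g = "\<lambda>s. \<Sum>z\<in>UNIV. ennreal (pmf (P s) z) * ennreal (?f (s, z))"
  have [measurable]: "log_ratio Q P \<in> borel_measurable (borel \<Otimes>\<^sub>M count_space UNIV)"
    unfolding log_ratio_def using P_measurable Q_measurable by (intro whole_P.measurable_pair_bool) auto
  have [measurable]: "?g \<in> borel_measurable borel"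
    using P_measurable by measurable
  have "(\<integral>\<^sup>+s. ?g s \<partial>D) \<le> ennreal (eps1 D P Q \<P>)"
  proof (rule nn_integral_le_cells)
    fix A assume A: "A \<in> \<P>"
    interpret cell: two_kernels "uniform_measure D A" P Q by (rule two_kernels_cell[OF A])
    have "(\<integral>\<^sup>+s. ?g s \<partial>uniform_measure D A) = (\<integral>\<^sup>+x. ?f x \<partial>joint (uniform_measure D A) P)"
      by (subst cell.P.nn_integral_joint) auto
    also have "\<dots> = ennreal cell.sq_error"
      unfolding cell.sq_error_def by (rule nn_integral_eq_integral[OF cell.square_integrable]) simp
    also have "\<dots> \<le> ennreal (eps1 D P Q \<P>)" by (intro ennreal_leI eps1_ge A)
    finally show "(\<integral>\<^sup>+s. ?g s \<partial>uniform_measure D A) \<le> ennreal (eps1 D P Q \<P>)" .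
  qed simp
  then have le: "(\<integral>\<^sup>+x. ?f x \<partial>joint D P) \<le> ennreal (eps1 D P Q \<P>)"
    by (subst whole_P.nn_integral_joint) auto
  then have int: "integrable (joint D P) ?f"
    by (intro integrableI_bounded) (auto intro: le_less_trans)
  then show tk: "two_kernels D P Q"
    using same_null_labels by unfold_locales auto
  show "two_kernels.sq_error D P Q \<le> eps1 D P Q \<P>"
    using le eps1_nonneg unfolding two_kernels.sq_error_def[OF tk]
    by (subst (asm) nn_integral_eq_integral[OF int]) auto
qed

lemma sigma_sq_ge: "info_var D P \<le> sigma_sq D P \<P>"
    "A \<in> \<P> \<Longrightarrow> info_var (uniform_measure D A) P \<le> sigma_sq D P \<P>"
  unfolding sigma_sq_def using partition(2) by (auto intro!: max.coboundedI1 Max_ge)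

lemma var_bound:
  assumes "two_kernels D' P Q" "two_kernels.sq_error D' P Q \<le> eps1 D P Q \<P>" "info_var D' P \<le> sigma_sq D P \<P>"
  defines "\<sigma> \<equiv> sqrt (sigma_sq D P \<P>)"
  shows "var (joint D' P) (llr D' P Q) \<le> eps1 D P Q \<P> + \<sigma>\<^sup>2 + 2 * \<sigma> * sqrt (eps1 D P Q \<P>)"
proof -
  interpret two_kernels D' P Q by fact
  have info0: "0 \<le> info_var D' P" unfolding info_var_def by (rule var_nonneg)
  \<comment> \<open>\<open>sigma_sq\<close> dominates a variance and is therefore nonnegative, so
    squaring undoes the root.\<close>
  then have sigma: "\<sigma>\<^sup>2 = sigma_sq D P \<P>" using assms(3) by (simp add: \<sigma>_def)
  have "sqrt (info_var D' P) * sqrt sq_error \<le> \<sigma> * sqrt (eps1 D P Q \<P>)"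
    using assms(2,3) info0 sq_error_nonneg unfolding \<sigma>_def by (intro mult_mono) auto
  then show ?thesis using var_llr_le assms(2,3) sigma by linarith
qed

section \<open>Selection of the query region\<close>

text \<open>The population value of \<open>info_estimate\<close>. It mixes kernels: the label
  entropy comes from P, the conditional entropy from Q.\<close>

definition score :: "(real ^ 'd) set \<Rightarrow> real" where
  "score A = labelled.label_entropy (uniform_measure D A) P - labelled.cond_entropy (uniform_measure D A) Q"

text \<open>The label entropy is computed from the exact class priors, so the only error is that of
  the pool average of log Q, which the second accuracy clause controls.\<close>

lemma info_estimate_close:
  assumes pool: "sufficient_pool D P Q \<P> \<eta> Su" and A: "A \<in> \<P>"
  shows "\<bar>info_estimate D P Q Su A - score A\<bar> \<le> \<eta>"
proof -
  interpret cell_P: labelled "uniform_measure D A" P by (rule labelled_cell[OF A])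
  interpret cell_Q: labelled "uniform_measure D A" Q by (rule labelled_cell[OF A])
  have "measure_pmf.expectation (Q s) (\<lambda>z. ln (pmf (Q s) z)) = (\<Sum>z\<in>UNIV. pmf (Q s) z * ln (pmf (Q s) z))" for s
    by (subst integral_measure_pmf_real[of UNIV]) (auto simp: mult.commute)
  then have "\<bar>pool_average Su A (\<lambda>s. \<Sum>z\<in>UNIV. pmf (Q s) z * ln (pmf (Q s) z)) - - cell_Q.cond_entropy\<bar> \<le> \<eta>"
    using pool A by (auto simp: sufficient_pool_def cell_Q.integral_ln_pmf dest!: bspec[OF _ A])
  then show ?thesis
    by (simp add: info_estimate_def score_def cell_P.label_entropy_def)
qed

text \<open>Two estimates together err by at most 2\<eta>, less than any positive gap between
  scores, so a maximiser of the estimate maximises the score exactly. Since \<eta> is fixed before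
  the pool, no trace of it remains in the bounds.\<close>

lemma selected_region_maximises_score:
  obtains \<eta> where "0 < \<eta>"
    "\<And>Su A B. sufficient_pool D P Q \<P> \<eta> Su \<Longrightarrow> selected_region D P Q \<P> Su A \<Longrightarrow> B \<in> \<P> \<Longrightarrow> score B \<le> score A"
proof -
  obtain \<eta> where \<eta>: "0 < \<eta>" "\<And>A B. A \<in> \<P> \<Longrightarrow> B \<in> \<P> \<Longrightarrow> score A < score B \<Longrightarrow> score A + 2 * \<eta> < score B"
    using finite_separated[OF partition(2), of score] by blast
  show ?thesis
  proof
    fix Su A B
    assume pool: "sufficient_pool D P Q \<P> \<eta> Su" and sel: "selected_region D P Q \<P> Su A" and B: "B \<in> \<P>"
    have A: "A \<in> \<P>" "info_estimate D P Q Su B \<le> info_estimate D P Q Su A"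
      using sel B by (auto simp: selected_region_def is_arg_max_def not_less)
    show "score B \<le> score A"
    proof (rule ccontr)
      assume "\<not> score B \<le> score A"
      then have "score A + 2 * \<eta> < score B" using \<eta>(2) A B by auto
      then show False
        using info_estimate_close[OF pool A(1)] info_estimate_close[OF pool B] A(2) by linarith
    qed
  qed (rule \<eta>)
qed

text \<open>The information in \<open>B\<close> exceeds its score by at most sqrt \<epsilon>2, and
  the score of \<open>A\<close> exceeds the information in \<open>A\<close> by at most sqrt
  \<epsilon>1. The mean of \<open>log_ratio\<close> is kept explicit, since its extremal case
  decides degeneracy.\<close>

lemma drift_cell:
  assumes A: "A \<in> \<P>" and B: "B \<in> \<P>" and score: "score B \<le> score A"
  shows "mutual_info (uniform_measure D B) P - sqrt (eps1 D P Q \<P>) - sqrt (eps2 D P Q \<P>)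
      \<le> - (\<integral>y. llr (uniform_measure D A) P Q y \<partial>joint (uniform_measure D A) P)
        - (\<integral>x. log_ratio Q P x \<partial>joint (uniform_measure D A) P)"
proof -
  interpret A: two_kernels "uniform_measure D A" P Q by (rule two_kernels_cell[OF A])
  \<comment> \<open>The kernels are exchanged, so \<open>B.P\<close> refers to Q and
    \<open>B.Q\<close> to P.\<close>
  interpret B: two_kernels "uniform_measure D B" Q P by (rule two_kernels_cell_swap[OF B])
  have "A.P.cond_entropy - A.Q.cond_entropy \<le> sqrt (eps1 D P Q \<P>)"
    using A.cond_entropy_diff_le real_sqrt_le_mono[OF eps1_ge[OF A]] by linarith
  moreover have "B.P.cond_entropy - B.Q.cond_entropy \<le> sqrt (eps2 D P Q \<P>)"
    using B.cond_entropy_diff_le real_sqrt_le_mono[OF eps2_ge[OF B]] by linarith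
  ultimately show ?thesis
    using score unfolding A.integral_llr A.P.mutual_info_eq B.Q.mutual_info_eq score_def by linarith
qed

text \<open>Zero error under P makes the kernels equal almost everywhere on each cell, so the
  reversed log-ratios vanish as well. This settles the extremal case of the active test.\<close>

lemma eps1_0_imp_eps2_0:
  assumes "eps1 D P Q \<P> = 0"
  shows "eps2 D P Q \<P> = 0"
proof -
  have "(\<integral>x. (log_ratio P Q x)\<^sup>2 \<partial>joint (uniform_measure D A) Q) = 0" if A: "A \<in> \<P>" for A
  proof -
    interpret A: two_kernels "uniform_measure D A" P Q by (rule two_kernels_cell[OF A])
    interpret A': two_kernels "uniform_measure D A" Q P by (rule two_kernels_cell_swap[OF A])
    have "A.sq_error = 0"
      using eps1_ge[OF A] A.sq_error_nonneg assms by simp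
    then have "AE s in uniform_measure D A. \<forall>z. pmf (Q s) z = pmf (P s) z"
      by (rule A.sq_error_0_imp_kernels_eq)
    then have "AE s in uniform_measure D A.
        (\<Sum>z\<in>UNIV. pmf (Q s) z * (ln (pmf (P s) z / pmf (Q s) z))\<^sup>2) = 0"
      by eventually_elim (auto simp: divide_self_if intro!: sum.neutral)
    then have "A'.sq_error = (\<integral>s. 0 \<partial>uniform_measure D A)"
      unfolding A'.sq_error_eq by (intro integral_cong_AE) auto
    then show ?thesis by (simp add: A'.sq_error_def)
  qed
  then have "(\<lambda>A. \<integral>x. (log_ratio P Q x)\<^sup>2 \<partial>joint (uniform_measure D A) Q) ` \<P> = {0}"
    using cells_nonempty by auto
  then show ?thesis by (simp add: eps2_def)
qed

end

section \<open>Power bounds for the active and the baseline test\<close>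

theorem theorem5p10:
  fixes D :: "(real ^ 'd) measure"
    and P Q :: "'d kernel"
    and \<P> :: "(real ^ 'd) set set"
    and \<Delta> :: real
  defines "\<epsilon>1 \<equiv> eps1 D P Q \<P>"
    and "\<epsilon>2 \<equiv> eps2 D P Q \<P>"
    and "\<sigma> \<equiv> sqrt (sigma_sq D P \<P>)"
  assumes D: "prob_space D" "sets D = sets borel"
    and P_measurable: "\<And>z. (\<lambda>s. pmf (P s) z) \<in> borel_measurable borel"
    and Q_measurable: "\<And>z. (\<lambda>s. pmf (Q s) z) \<in> borel_measurable borel"
    and H1: "alternative_H1 D P"
    and partition: "partition_on (topological_support D) \<P>" "finite \<P>"
    and cells: "\<And>A. A \<in> \<P> \<Longrightarrow> A \<in> sets borel" "\<And>A. A \<in> \<P> \<Longrightarrow> measure D A > 0"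
    and same_null_labels: "AE s in D. \<forall>z. pmf (P s) z = 0 \<longleftrightarrow> pmf (Q s) z = 0"
    and eps1_finite: "\<And>A. A \<in> \<P> \<Longrightarrow>
          integrable (joint (uniform_measure D A) P) (\<lambda>x. (log_ratio Q P x)\<^sup>2)"
    and eps2_finite: "\<And>A. A \<in> \<P> \<Longrightarrow>
          integrable (joint (uniform_measure D A) Q) (\<lambda>x. (log_ratio P Q x)\<^sup>2)"
    and max_gain: "Max ((\<lambda>A. mutual_info (uniform_measure D A) P) ` \<P>) - mutual_info D P = \<Delta>"
          "\<Delta> \<ge> 0"
    and nonzero_denominator: "\<epsilon>1 + \<sigma>\<^sup>2 + 2 * \<sigma> * sqrt \<epsilon>1 > 0"
  shows "(\<exists>\<eta>>0. \<forall>Su Astar.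
            sufficient_pool D P Q \<P> \<eta> Su \<longrightarrow>
            selected_region D P Q \<P> Su Astar \<longrightarrow>
            power_approx_at_least (uniform_measure D Astar) P Q
              (\<lambda>Nq \<alpha>. (ln \<alpha> / sqrt (real Nq)
                        + sqrt (real Nq) * (mutual_info D P + \<Delta> - 2 * sqrt \<epsilon>1 - sqrt \<epsilon>2))
                      / sqrt (\<epsilon>1 + \<sigma>\<^sup>2 + 2 * \<sigma> * sqrt \<epsilon>1)))
       \<and> power_approx_at_least D P Q
              (\<lambda>Nq \<alpha>. (ln \<alpha> / sqrt (real Nq)
                        + sqrt (real Nq) * (mutual_info D P - sqrt \<epsilon>1))
                      / sqrt (\<epsilon>1 + \<sigma>\<^sup>2 + 2 * \<sigma> * sqrt \<epsilon>1))"
proof -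
  interpret partitioned_model D P Q \<P>
    using D P_measurable Q_measurable partition cells same_null_labels eps1_finite eps2_finite
    by (rule partitioned_model.intro)
  let ?I = "mutual_info D P" and ?V = "\<epsilon>1 + \<sigma>\<^sup>2 + 2 * \<sigma> * sqrt \<epsilon>1"
  \<comment> \<open>The alternative hypothesis enters through this strict inequality, which excludes
    the degenerate log-ratios below.\<close>
  have I: "0 < ?I" by (rule whole_P.alternative_H1_imp_mutual_info_pos[OF H1])
  \<comment> \<open>A most informative region, against which the selected one is compared.\<close>
  obtain B where B: "B \<in> \<P>" "mutual_info (uniform_measure D B) P = ?I + \<Delta>"
  proof -
    have "Max ((\<lambda>A. mutual_info (uniform_measure D A) P) ` \<P>) \<in> (\<lambda>A. mutual_info (uniform_measure D A) P) ` \<P>"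
      using partition(2) cells_nonempty by (intro Max_in) auto
    then show ?thesis using that max_gain(1) by force
  qed
  obtain \<eta> where \<eta>: "0 < \<eta>" "\<And>Su A B. sufficient_pool D P Q \<P> \<eta> Su \<Longrightarrow>
      selected_region D P Q \<P> Su A \<Longrightarrow> B \<in> \<P> \<Longrightarrow> score B \<le> score A"
    using selected_region_maximises_score by blast
  have active: "power_approx_at_least (uniform_measure D A) P Q
      (\<lambda>Nq \<alpha>. (ln \<alpha> / sqrt (real Nq) + sqrt (real Nq) * (?I + \<Delta> - 2 * sqrt \<epsilon>1 - sqrt \<epsilon>2)) / sqrt ?V)"
    if pool: "sufficient_pool D P Q \<P> \<eta> Su" and sel: "selected_region D P Q \<P> Su A" for Su A
  proof -
    have A: "A \<in> \<P>" using sel by (simp add: selected_region_def is_arg_max_def)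
    interpret A: two_kernels "uniform_measure D A" P Q by (rule two_kernels_cell[OF A])
    let ?m = "\<integral>y. llr (uniform_measure D A) P Q y \<partial>joint (uniform_measure D A) P"
    let ?w = "\<integral>x. log_ratio Q P x \<partial>joint (uniform_measure D A) P"
    have drift: "?I + \<Delta> - sqrt \<epsilon>1 - sqrt \<epsilon>2 \<le> - ?m - ?w"
      using drift_cell[OF A B(1) \<eta>(2)[OF pool sel B(1)]] by (simp add: B(2) \<epsilon>1_def \<epsilon>2_def)
    have e1: "A.sq_error \<le> \<epsilon>1" using eps1_ge[OF A] by (simp add: \<epsilon>1_def)
    have w: "- sqrt \<epsilon>1 \<le> ?w"
      using A.abs_integral_log_ratio_le real_sqrt_le_mono[OF e1] by linarith
    show ?thesis
    proof (rule A.power_approx)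
      show "?I + \<Delta> - 2 * sqrt \<epsilon>1 - sqrt \<epsilon>2 \<le> - ?m" using drift w by linarith
      show "var (joint (uniform_measure D A) P) (llr (uniform_measure D A) P Q) \<le> ?V"
        unfolding \<epsilon>1_def \<sigma>_def by (rule var_bound[OF two_kernels_cell[OF A] eps1_ge[OF A] sigma_sq_ge(2)[OF A]])
    next
      \<comment> \<open>Both bounds on \<open>?w\<close> are then attained, so \<epsilon>1 and hence
        \<epsilon>2 vanish, leaving \<open>?I + \<Delta> = 0\<close> against \<open>0 < ?I\<close>
        and \<open>\<Delta> \<ge> 0\<close>.\<close>
      assume 0: "?I + \<Delta> - 2 * sqrt \<epsilon>1 - sqrt \<epsilon>2 = 0" "?m = 0"
      then have "- ?w = sqrt \<epsilon>1" using drift w by linarith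
      then have "\<epsilon>1 = 0" using e1 by (rule A.extremal_imp_kernels_eq)
      moreover from this have "\<epsilon>2 = 0" using eps1_0_imp_eps2_0 by (simp add: \<epsilon>1_def \<epsilon>2_def)
      ultimately show "var (joint (uniform_measure D A) P) (llr (uniform_measure D A) P Q) \<noteq> 0"
        using 0(1) I max_gain(2) by simp
    qed (rule nonzero_denominator)
  qed
  interpret W: two_kernels D P Q by (rule two_kernels_whole)
  let ?m = "\<integral>y. llr D P Q y \<partial>joint D P" and ?w = "\<integral>x. log_ratio Q P x \<partial>joint D P"
  have e1: "W.sq_error \<le> \<epsilon>1" using sq_error_whole_le by (simp add: \<epsilon>1_def)
  have m: "- ?m = ?I + ?w" using W.integral_llr by simp
  have "power_approx_at_least D P Q
      (\<lambda>Nq \<alpha>. (ln \<alpha> / sqrt (real Nq) + sqrt (real Nq) * (?I - sqrt \<epsilon>1)) / sqrt ?V)"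
  proof (rule W.power_approx)
    show "?I - sqrt \<epsilon>1 \<le> - ?m"
      using m W.abs_integral_log_ratio_le real_sqrt_le_mono[OF e1] by linarith
    show "var (joint D P) (llr D P Q) \<le> ?V"
      unfolding \<epsilon>1_def \<sigma>_def by (rule var_bound[OF two_kernels_whole sq_error_whole_le sigma_sq_ge(1)])
  next
    \<comment> \<open>Again the error bound is attained; \<epsilon>1 = 0 would give
      \<open>?I = 0\<close>.\<close>
    assume 0: "?I - sqrt \<epsilon>1 = 0" "?m = 0"
    then have "- ?w = sqrt \<epsilon>1" using m by linarith
    then have "\<epsilon>1 = 0" using e1 by (rule W.extremal_imp_kernels_eq)
    then show "var (joint D P) (llr D P Q) \<noteq> 0" using 0(1) I by simp
  qed (rule nonzero_denominator)
  then show ?thesis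
    by (intro conjI exI[of _ \<eta>] allI impI \<eta>(1) active)
qed

end
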